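(* Let $p\ge1$, $s\in(0,1)$ with $sp<1$, and $T\in\mathbb{N}$. The unique critical point (up to translations) of $\mathcal{F}^s_p$ in $\mathbb{X}^0_T$ is the equispaced configuration $\mathbf{X}^{\mathrm{eq}}=\mathbb{Z}$. Moreover, $\mathbf{X}^{\mathrm{eq}}$ is the unique (up to translations) local and global minimiser of $\mathcal{F}^s_p$ in $\mathbb{X}_T$.
   Context: One-dimensional setting. Let $T\in\mathbb{N}$. A configuration is a set $\mathbf{X}=\bigcup_{k\in\mathbb{Z}}(\bar{\mathbf{X}}+kT)$ with $\bar{\mathbf{X}}=(x_1,\dots,x_T)\in[0,T)^T$, $x_i\le x_j$ for $i<j$ (points counted with multiplicity); $\mathbb{X}_T$ is the set of configurations, identified with the vectors $\bar{\mathbf{X}}$ (local minimality is with respect to the positions $x_1,\dots,x_T$). $\mathrm{d}[\mathbf{X}]$ is the minimal distance $|x_i-x_j|$ between points with distinct indices, and $\mathbb{X}^0_T$ is the set of configurations with $\mathrm{d}[\mathbf{X}]>0$. Translations: $\mathbf{X}+a=\{x+a:x\in\mathbf{X}\}$, $a\in\mathbb{R}$. For $\mathbf{X}\in\mathbb{X}_T$, $u[\mathbf{X}]$ is the $T$-periodic function (defined up to an additive constant) with distributional derivative $\mathrm{D}u[\mathbf{X}]=\mathcal{L}^1-\sum_{x\in\mathbf{X}}\delta_x$ (multiplicities counted), and $\mathcal{F}^s_p[\mathbf{X}]=\int_0^T\int_{\mathbb{R}}\frac{|u[\mathbf{X}](x)-u[\mathbf{X}](y)|^p}{|x-y|^{1+sp}}\,\mathrm{d}y\,\mathrm{d}x$.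 A critical point in $\mathbb{X}^0_T$ is a configuration at which all the derivatives $\frac{\mathrm{d}}{\mathrm{d}h}\mathcal{F}^s_p[\mathbf{X}+he_i]\big|_{h=0}$, $i=1,\dots,T$, vanish, where $\mathbf{X}+he_i$ is obtained by replacing $x_i$ with $x_i+h$ (and its periodic copies accordingly). *)

theory Defs
  imports "HOL-Analysis.Analysis"
begin

text \<open>A configuration in X_T is represented by the list [x_1,...,x_T] of its
  representatives in [0,T), sorted, with multiplicities.\<close>
definition config :: "nat \<Rightarrow> real list \<Rightarrow> bool" where
  "config T xs \<longleftrightarrow> length xs = T \<and> sorted xs \<and> (\<forall>x\<in>set xs. 0 \<le> x \<and> x < real T)"

definition config_set :: "nat \<Rightarrow> real list \<Rightarrow> real set" where
  "config_set T xs = {xs ! i + real_of_int k * real T | i k. i < length xs}"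

definition config0 :: "nat \<Rightarrow> real list \<Rightarrow> bool" where
  "config0 T xs \<longleftrightarrow> config T xs \<and>
     (\<forall>i j. i < length xs \<longrightarrow> j < length xs \<longrightarrow> i \<noteq> j \<longrightarrow> xs ! i \<noteq> xs ! j)"

text \<open>The T-periodic function u with Du = Lebesgue - sum of Dirac masses at the
  points x_i + kT (fixed additive constant).  Works for arbitrary real positions.\<close>
definition u_fun :: "nat \<Rightarrow> real list \<Rightarrow> real \<Rightarrow> real" where
  "u_fun T xs x = x - sum_list (map (\<lambda>xi. real_of_int \<lfloor>(x - xi) / real T\<rfloor>) xs)"

text \<open>The energy F^s_p (finite when sp < 1).\<close>
definition F_energy :: "real \<Rightarrow> real \<Rightarrow> nat \<Rightarrow> real list \<Rightarrow> real" where
  "F_energy s p T xs = enn2real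
     (\<integral>\<^sup>+ x. \<integral>\<^sup>+ y. indicator {0..real T} x *
        ennreal (\<bar>u_fun T xs x - u_fun T xs y\<bar> powr p / \<bar>x - y\<bar> powr (1 + s * p))
      \<partial>lborel \<partial>lborel)"

definition critical_point :: "real \<Rightarrow> real \<Rightarrow> nat \<Rightarrow> real list \<Rightarrow> bool" where
  "critical_point s p T xs \<longleftrightarrow> (\<forall>i < length xs.
     ((\<lambda>h. F_energy s p T (xs[i := xs ! i + h])) has_real_derivative 0) (at 0))"

text \<open>Local minimiser with respect to the positions x_1,...,x_T (moved freely,
  with their periodic copies).\<close>
definition local_min :: "real \<Rightarrow> real \<Rightarrow> nat \<Rightarrow> real list \<Rightarrow> bool" where
  "local_min s p T xs \<longleftrightarrow> (\<exists>\<epsilon>>0. \<forall>ys. length ys = length xs \<longrightarrow>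
     (\<forall>i < length xs. \<bar>ys ! i - xs ! i\<bar> < \<epsilon>) \<longrightarrow> F_energy s p T xs \<le> F_energy s p T ys)"

definition global_min :: "real \<Rightarrow> real \<Rightarrow> nat \<Rightarrow> real list \<Rightarrow> bool" where
  "global_min s p T xs \<longleftrightarrow> (\<forall>ys. config T ys \<longrightarrow> F_energy s p T xs \<le> F_energy s p T ys)"

definition translate_of_eq :: "nat \<Rightarrow> real list \<Rightarrow> bool" where
  "translate_of_eq T xs \<longleftrightarrow> (\<exists>a. config_set T xs = (\<lambda>z. real_of_int z + a) ` UNIV)"

end

theory Submission
  imports Defs
begin

text \<open>Index the points as a nondecreasing sequence \<open>x\<close> on the integers with
  \<open>x (j + T) = x j + T\<close>, and let \<open>N\<close> be the number of points in \<open>(z, z + r]\<close>, so that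
  \<open>u (z + r) - u z = r - N\<close>.  Expanding the convex sequence \<open>f n = \<bar>r - n\<bar> powr p\<close> as an affine
  function plus a combination of the kinks \<open>max 0 (n - k)\<close>, with the nonnegative second differences
  of \<open>f\<close> as coefficients, and integrating over a period, where \<open>max 0 (N - k)\<close> contributes
  \<open>\<Sum>i<T. max 0 (r - (x (i + k) - x i))\<close>, exhibits the energy as a convex function of \<open>x\<close> on the
  cone of ordered configurations.  Since \<open>\<Sum>i<T. (x (i + k) - x i) = k T\<close>, Jensen's inequality makes
  the equispaced sequence a minimiser; the term of adjacent points with \<open>r\<close> near 1 makes it strict.
  Convexity carries this over to local minimisers and critical points.\<close>

subsection \<open>Counting points in a window\<close>

text \<open>The number of points in a window jumps as the points move, so convexity in the positions
  is invisible for a fixed window. It appears after averaging over the left end \<open>z\<close>,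
  because the integral of a floor over one period is exactly linear in its shift. The resulting
  formula needs ordered sequences, so every competitor has to be kept in the ordered cone: convex
  combinations stay there even when points coincide, and a single displacement stays there when it
  is small against the least gap. For \<open>p = 1\<close> the power is not strictly convex on the
  reals. Strictness survives because \<open>N\<close> is an integer: with \<open>0 < r < 2\<close>
  the values of \<open>f\<close> at 0, 1, 2 have a positive second difference for every
  \<open>p \<ge> 1\<close>. A critical point provides partial derivatives only, not a derivative in
  the direction of an equispaced sequence. Convexity closes this gap by writing the point as a
  mixture of that sequence and of displacements of single points.\<close>

definition quasi_periodic :: "nat \<Rightarrow> (int \<Rightarrow> real) \<Rightarrow> bool" where
  "quasi_periodic T x \<longleftrightarrow> mono x \<and> (\<forall>j. x (j + int T) = x j + real T)"

text \<open>A signed count, normalised separately in each residue class; only its increments matter,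
  and for \<open>z \<le> w\<close> the increment is the number of points in
  \<open>(z, w]\<close>.\<close>

definition count_upto :: "nat \<Rightarrow> (int \<Rightarrow> real) \<Rightarrow> real \<Rightarrow> int" where
  "count_upto T x z = (\<Sum>i<T. \<lfloor>(z - x (int i)) / real T\<rfloor>)"

definition pair_excess :: "nat \<Rightarrow> (int \<Rightarrow> real) \<Rightarrow> real \<Rightarrow> nat \<Rightarrow> real" where
  "pair_excess T x r k = (\<Sum>i<T. max 0 (r - (x (int i + int k) - x (int i))))"

text \<open>The difference is centred at \<open>Suc k\<close>, and it will be the coefficient of the
  kink there; kinks start at 1 because the arguments are natural numbers.\<close>

definition second_diff :: "(nat \<Rightarrow> real) \<Rightarrow> nat \<Rightarrow> real" where
  "second_diff f k = f (Suc (Suc k)) - 2 * f (Suc k) + f k"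

lemma quasi_periodicD:
  assumes "quasi_periodic T x"
  shows "i \<le> j \<Longrightarrow> x i \<le> x j" and "x (j + int T) = x j + real T"
  using assms by (auto simp: quasi_periodic_def mono_def)

text \<open>Passing from \<open>k\<close> to \<open>Suc k\<close> drops the term at \<open>k\<close>
  and gains the one at \<open>k + T\<close>, which is larger by \<open>c\<close>. The ring is left
  general so that positions and integer floors are both covered.\<close>

lemma sum_window_shift:
  fixes f :: "int \<Rightarrow> 'a::ring_1"
  assumes "\<And>j. f (j + int T) = f j + c"
  shows "(\<Sum>i<T. f (int i + int k)) = (\<Sum>i<T. f (int i)) + of_nat k * c"
proof (induction k)
  case (Suc k)
  have "(\<Sum>i<T. f (int i + int (Suc k))) + f (int k) = (\<Sum>i<Suc T. f (int i + int k))"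
    by (subst sum.lessThan_Suc_shift) (simp add: algebra_simps)
  also have "\<dots> = (\<Sum>i<T. f (int i + int k)) + (f (int k) + c)"
    using assms[of "int k"] by (simp add: add.commute)
  finally have "(\<Sum>i<T. f (int i + int (Suc k))) = (\<Sum>i<T. f (int i + int k)) + c"
    by simp
  then show ?case using Suc by (simp add: algebra_simps)
qed simp

lemma add_mult_period:
  fixes x :: "int \<Rightarrow> real"
  assumes "\<And>j. x (j + int T) = x j + real T"
  shows "x (j + m * int T) = x j + real_of_int m * real T"
proof (induction m rule: int_induct[where k = 0])
  case (step1 i)
  show ?case using step1 assms[of "j + i * int T"] by (simp add: algebra_simps)
next
  case (step2 i)
  show ?case using step2 assms[of "j + (i - 1) * int T"] by (simp add: algebra_simps)
qed simp

lemma quasi_periodic_add_mult: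
  assumes "quasi_periodic T x"
  shows "x (j + m * int T) = x j + real_of_int m * real T"
  using quasi_periodicD(2)[OF assms] by (rule add_mult_period)

lemma sum_gaps:
  assumes "quasi_periodic T x"
  shows "(\<Sum>i<T. x (int i + int k) - x (int i)) = real k * real T"
  using sum_window_shift[of x T "real T" k] quasi_periodicD(2)[OF assms]
  by (simp add: sum_subtractf)

text \<open>A point replaced by its copy one period later lowers its floor by 1, and the shift by
  \<open>k\<close> makes \<open>k\<close> such replacements.\<close>

lemma sum_floor_shifted:
  assumes "quasi_periodic T x" "T \<ge> 1"
  shows "(\<Sum>i<T. \<lfloor>(z - x (int i + int k)) / real T\<rfloor>) = count_upto T x z - int k"
proof -
  have "\<lfloor>(z - x (j + int T)) / real T\<rfloor> = \<lfloor>(z - x j) / real T\<rfloor> + - 1" for j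
  proof -
    have "(z - x (j + int T)) / real T = (z - x j) / real T - 1"
      using assms by (simp add: quasi_periodicD(2)[OF assms(1)] field_simps)
    then show ?thesis by simp
  qed
  from sum_window_shift[of "\<lambda>j. \<lfloor>(z - x j) / real T\<rfloor>", OF this]
  show ?thesis by (simp add: count_upto_def)
qed

lemma sum_max_0_same_sign:
  fixes f :: "'a \<Rightarrow> int"
  assumes "\<And>i j. i \<in> A \<Longrightarrow> j \<in> A \<Longrightarrow> f i > 0 \<Longrightarrow> f j < 0 \<Longrightarrow> False"
  shows "(\<Sum>i\<in>A. max 0 (f i)) = max 0 (\<Sum>i\<in>A. f i)"
proof (cases "\<exists>i\<in>A. f i > 0")
  case True
  then have "f j \<ge> 0" if "j \<in> A" for j using assms that by (meson not_le_imp_less)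
  then show ?thesis by (simp add: sum_nonneg)
next
  case False
  then have "f j \<le> 0" if "j \<in> A" for j using that by (meson not_le_imp_less)
  then show ?thesis by (simp add: max_absorb1 sum_nonpos)
qed

text \<open>The positive part of the excess over \<open>k\<close> of the number of points in \<open>(z, w]\<close> counts the
  pairs \<open>(j, j + k)\<close> of indices with both points in \<open>(z, w]\<close>; grouping the indices modulo \<open>T\<close>
  turns each class into a difference of floors.  No class has the wrong sign since the points
  are ordered.\<close>
lemma count_excess:
  assumes x: "quasi_periodic T x" and T: "T \<ge> 1"
  shows "max 0 (count_upto T x w - count_upto T x z - int k) =
    (\<Sum>i<T. max 0 (\<lfloor>(w - x (int i + int k)) / real T\<rfloor> - \<lfloor>(z - x (int i)) / real T\<rfloor>))"
proof -
  define f where "f i = \<lfloor>(w - x (int i + int k)) / real T\<rfloor> - \<lfloor>(z - x (int i)) / real T\<rfloor>" for i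
  have le_iff: "m \<le> \<lfloor>(v - x j) / real T\<rfloor> \<longleftrightarrow> x (j + m * int T) \<le> v" for m v j
    using T by (simp add: le_floor_iff quasi_periodic_add_mult[OF x] field_simps)
  have "(\<Sum>i<T. max 0 (f i)) = max 0 (\<Sum>i<T. f i)"
  proof (rule sum_max_0_same_sign)
    fix i j assume "f i > 0" "f j < 0"
    \<comment> \<open>\<open>a\<close> is the last index in the class of \<open>i\<close> with
      \<open>x (a + k) \<le> w\<close>, and \<open>f i > 0\<close> says that \<open>x a\<close> lies
      beyond \<open>z\<close>. \<open>b\<close> is the last index in the class of \<open>j\<close>
      with \<open>x b \<le> z\<close>, and \<open>f j < 0\<close> says that \<open>x (b + k)\<close>
      lies beyond \<open>w\<close>. Monotonicity then gives both \<open>b < a\<close> and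
      \<open>a < b\<close>.\<close>
    define a where "a = int i + \<lfloor>(w - x (int i + int k)) / real T\<rfloor> * int T"
    define b where "b = int j + \<lfloor>(z - x (int j)) / real T\<rfloor> * int T"
    have "x (a + int k) \<le> w" using le_iff[of "\<lfloor>(w - x (int i + int k)) / real T\<rfloor>" w "int i + int k"]
      by (auto simp: a_def algebra_simps)
    moreover have "\<not> x a \<le> z" using \<open>f i > 0\<close> le_iff[of "\<lfloor>(w - x (int i + int k)) / real T\<rfloor>" z "int i"]
      by (simp add: a_def f_def)
    moreover have "x b \<le> z" using le_iff[of _ z "int j"] by (auto simp: b_def)
    moreover have "\<not> x (b + int k) \<le> w"
      using \<open>f j < 0\<close> le_iff[of "\<lfloor>(z - x (int j)) / real T\<rfloor>" w "int j + int k"]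
      by (auto simp: b_def f_def algebra_simps)
    ultimately show False
      using quasi_periodicD(1)[OF x, of a b] quasi_periodicD(1)[OF x, of "b + int k" "a + int k"]
      by linarith
  qed
  also have "(\<Sum>i<T. f i) = count_upto T x w - count_upto T x z - int k"
    unfolding f_def sum_subtractf sum_floor_shifted[OF x T] by (simp add: count_upto_def)
  finally show ?thesis by (simp add: f_def)
qed

text \<open>Discrete Taylor formula with second-order remainder. Kinks at or beyond \<open>n\<close>
  contribute nothing, so one truncation \<open>K\<close> serves all \<open>n \<le> Suc K\<close> and
  the finite sum can be integrated term by term.\<close>

lemma second_diff_expansion:
  assumes "n \<le> Suc K"
  shows "f n = f 0 + (f 1 - f 0) * real n
           + (\<Sum>k<K. second_diff f k * max 0 (real n - real (Suc k)))"
  using assms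
proof (induction n)
  case (Suc n)
  have eq: "max 0 (real (Suc n) - real (Suc k)) = max 0 (real n - real (Suc k)) + (if k < n then 1 else 0)"
    for k by auto
  have "f (Suc m) - f m = f 1 - f 0 + (\<Sum>k<m. second_diff f k)" for m
    by (induction m) (auto simp: second_diff_def)
  from this[of n]
  have "f (Suc n) = f n + (f 1 - f 0) + (\<Sum>k<n. second_diff f k)" by simp
  also have "(\<Sum>k<n. second_diff f k) = (\<Sum>k<K. second_diff f k * (if k < n then 1 else 0))"
    using Suc.prems by (intro sum.mono_neutral_cong_left) auto
  finally show ?case
    using Suc unfolding eq by (simp add: algebra_simps sum.distrib)
qed simp

text \<open>With \<open>a = m T + b\<close> and \<open>0 \<le> b < T\<close>, the floor is
  \<open>- m - 1\<close> on \<open>[0, b)\<close> and \<open>- m\<close> on \<open>[b, T)\<close>,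
  which integrates to \<open>- m T - b\<close>. The closed indicators used instead differ from it at
  most at \<open>b\<close> and \<open>T\<close>.\<close>

lemma has_bochner_integral_floor:
  assumes "T \<ge> 1"
  shows "has_bochner_integral lborel
    (\<lambda>z. indicator {0..real T} z * real_of_int \<lfloor>(z - a) / real T\<rfloor>) (- a)"
proof -
  define m where "m = \<lfloor>a / real T\<rfloor>"
  define b where "b = a - real_of_int m * real T"
  have b: "0 \<le> b" "b < real T"
    using assms floor_divide_lower[of "real T" a] floor_divide_upper[of "real T" a]
    by (simp_all add: b_def m_def algebra_simps)
  have "has_bochner_integral lborel
      (\<lambda>z. indicator {0..real T} z * (- real_of_int m) + indicator {0..b} z * (- 1))
      (measure lborel {0..real T} * (- real_of_int m) + measure lborel {0..b} * (- 1))"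
    by (intro has_bochner_integral_add has_bochner_integral_mult_left
        has_bochner_integral_real_indicator) (use b in auto)
  then have "has_bochner_integral lborel
      (\<lambda>z. indicator {0..real T} z * (- real_of_int m) + indicator {0..b} z * (- 1)) (- a)"
    using b by (simp add: b_def algebra_simps)
  moreover have "AE z in lborel. z \<noteq> b \<and> z \<noteq> real T"
    using AE_lborel_singleton[of b] AE_lborel_singleton[of "real T"] by eventually_elim simp
  then have "AE z in lborel. indicator {0..real T} z * (- real_of_int m) + indicator {0..b} z * (- 1)
      = indicator {0..real T} z * real_of_int \<lfloor>(z - a) / real T\<rfloor>"
  proof eventually_elim
    case (elim z)
    have *: "(z - a) / real T = (z - b) / real T - real_of_int m"
      using assms by (simp add: b_def field_simps)
    consider "0 \<le> z" "z < b" | "b < z" "z < real T" | "z < 0 \<or> z > real T"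
      using elim by linarith
    then show ?case
    proof cases
      case 1
      then have "\<lfloor>(z - b) / real T\<rfloor> = - 1"
        using b assms by (simp add: floor_eq_iff field_simps)
      then show ?thesis using 1 b unfolding * by (simp add: indicator_def)
    next
      case 2
      then have "\<lfloor>(z - b) / real T\<rfloor> = 0"
        using b assms by (simp add: floor_eq_iff field_simps)
      then show ?thesis using 2 b unfolding * by (simp add: indicator_def)
    qed (use b in \<open>auto simp: indicator_def\<close>)
  qed
  ultimately show ?thesis
    by (subst has_bochner_integral_cong_AE[symmetric]) auto
qed

text \<open>The difference of the two floors has the same sign for all \<open>z\<close>, so its
  positive part is either the difference itself or zero.\<close>

lemma has_bochner_integral_max_floor_diff:
  assumes "T \<ge> 1"
  shows "has_bochner_integral lborel
    (\<lambda>z. indicator {0..real T} z * real_of_int (max 0 (\<lfloor>(z - a) / real T\<rfloor> - \<lfloor>(z - b) / real T\<rfloor>)))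
    (max 0 (b - a))"
proof (cases "a \<le> b")
  case True
  have "\<lfloor>(z - b) / real T\<rfloor> \<le> \<lfloor>(z - a) / real T\<rfloor>" for z
    using True by (intro floor_mono divide_right_mono) auto
  moreover have "has_bochner_integral lborel
    (\<lambda>z. indicator {0..real T} z * real_of_int \<lfloor>(z - a) / real T\<rfloor>
       - indicator {0..real T} z * real_of_int \<lfloor>(z - b) / real T\<rfloor>) (- a - (- b))"
    by (intro has_bochner_integral_diff has_bochner_integral_floor assms)
  ultimately show ?thesis using True by (simp add: algebra_simps)
next
  case False
  have "\<lfloor>(z - a) / real T\<rfloor> \<le> \<lfloor>(z - b) / real T\<rfloor>" for z
    using False by (intro floor_mono divide_right_mono) auto
  then show ?thesis using False by (simp add: max_absorb1 has_bochner_integral_zero)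
qed

text \<open>The offset \<open>a\<close> allows windows that begin to the left of \<open>z\<close>;
  it cancels because only gaps between points survive the integration.\<close>

lemma has_bochner_integral_count_excess:
  assumes x: "quasi_periodic T x" and T: "T \<ge> 1"
  shows "has_bochner_integral lborel
    (\<lambda>z. indicator {0..real T} z *
       max 0 (real_of_int (count_upto T x (z + a + r) - count_upto T x (z + a)) - real k))
    (pair_excess T x r k)"
proof -
  have "max 0 (real_of_int (count_upto T x (z + a + r) - count_upto T x (z + a)) - real k)
     = (\<Sum>i<T. real_of_int (max 0 (\<lfloor>(z - (x (int i + int k) - a - r)) / real T\<rfloor>
          - \<lfloor>(z - (x (int i) - a)) / real T\<rfloor>)))" for z
  proof -
    have "max 0 (real_of_int (count_upto T x (z + a + r) - count_upto T x (z + a)) - real k)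
      = real_of_int (max 0 (count_upto T x (z + a + r) - count_upto T x (z + a) - int k))"
      by (simp add: of_int_max)
    also note count_excess[OF x T]
    finally show ?thesis by (simp add: algebra_simps)
  qed
  moreover have "has_bochner_integral lborel
    (\<lambda>z. \<Sum>i<T. indicator {0..real T} z *
        real_of_int (max 0 (\<lfloor>(z - (x (int i + int k) - a - r)) / real T\<rfloor>
          - \<lfloor>(z - (x (int i) - a)) / real T\<rfloor>)))
    (\<Sum>i<T. max 0 (x (int i) - a - (x (int i + int k) - a - r)))"
    by (intro has_bochner_integral_sum has_bochner_integral_max_floor_diff T)
  moreover have "(\<Sum>i<T. max 0 (x (int i) - a - (x (int i + int k) - a - r))) = pair_excess T x r k"
    by (simp add: pair_excess_def algebra_simps)
  ultimately show ?thesis by (simp add: sum_distrib_left)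
qed

subsection \<open>The energy as an integral over window lengths\<close>

text \<open>The integral of \<open>\<bar>r - N\<bar> powr p\<close> over a period with the kink
  expansion already carried out. The summation bound exceeds \<open>N\<close> because
  \<open>N\<close> differs from \<open>r\<close> by at most \<open>T\<close>.\<close>

definition window_energy :: "real \<Rightarrow> nat \<Rightarrow> (int \<Rightarrow> real) \<Rightarrow> real \<Rightarrow> real" where
  "window_energy p T x r = (let f = (\<lambda>n. \<bar>r - real n\<bar> powr p) in
     f 0 * real T + (f 1 - f 0) * pair_excess T x r 0
     + (\<Sum>k<nat \<lceil>r\<rceil> + T. second_diff f k * pair_excess T x r (Suc k)))"

definition energy_density :: "real \<Rightarrow> real \<Rightarrow> nat \<Rightarrow> (int \<Rightarrow> real) \<Rightarrow> real \<Rightarrow> real" where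
  "energy_density s p T x r = window_energy p T x \<bar>r\<bar> / \<bar>r\<bar> powr (1 + s * p)"

definition energy :: "real \<Rightarrow> real \<Rightarrow> nat \<Rightarrow> (int \<Rightarrow> real) \<Rightarrow> real" where
  "energy s p T x = (LBINT r. energy_density s p T x r)"

lemma count_upto_mono: "z \<le> w \<Longrightarrow> count_upto T x z \<le> count_upto T x w"
  unfolding count_upto_def by (intro sum_mono floor_mono divide_right_mono) auto

text \<open>Each of the \<open>T\<close> residue classes has density \<open>1 / T\<close>, so its
  count in the window is off from \<open>r / T\<close> by at most 1.\<close>

lemma count_upto_discrepancy:
  assumes "T \<ge> 1"
  shows "\<bar>r - real_of_int (count_upto T x (z + r) - count_upto T x z)\<bar> \<le> real T"
proof -
  have "r - real_of_int (count_upto T x (z + r) - count_upto T x z) =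
     (\<Sum>i<T. r / real T - real_of_int (\<lfloor>(z + r - x (int i)) / real T\<rfloor> - \<lfloor>(z - x (int i)) / real T\<rfloor>))"
    using assms by (simp add: count_upto_def sum_subtractf)
  also have "\<bar>\<dots>\<bar> \<le> (\<Sum>i<T. \<bar>r / real T -
      real_of_int (\<lfloor>(z + r - x (int i)) / real T\<rfloor> - \<lfloor>(z - x (int i)) / real T\<rfloor>)\<bar>)"
    by (rule sum_abs)
  also have "\<dots> \<le> (\<Sum>i<T. 1)"
  proof (rule sum_mono)
    fix i
    have "(z + r - x (int i)) / real T = (z - x (int i)) / real T + r / real T"
      by (simp add: add_divide_distrib[symmetric])
    then show "\<bar>r / real T - real_of_int (\<lfloor>(z + r - x (int i)) / real T\<rfloor> - \<lfloor>(z - x (int i)) / real T\<rfloor>)\<bar> \<le> 1"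
      using floor_correct[of "(z + r - x (int i)) / real T"] floor_correct[of "(z - x (int i)) / real T"]
      by linarith
  qed
  finally show ?thesis by simp
qed

lemma has_bochner_integral_window_energy:
  assumes x: "quasi_periodic T x" and T: "T \<ge> 1" and r: "r \<ge> 0"
  shows "has_bochner_integral lborel
    (\<lambda>z. indicator {0..real T} z *
       \<bar>r - real_of_int (count_upto T x (z + a + r) - count_upto T x (z + a))\<bar> powr p)
    (window_energy p T x r)"
proof -
  define f where "f n = \<bar>r - real n\<bar> powr p" for n
  define N where "N z = real_of_int (count_upto T x (z + a + r) - count_upto T x (z + a))" for z
  define K where "K = nat \<lceil>r\<rceil> + T"
  have expand: "\<bar>r - N z\<bar> powr p = f 0 + (f 1 - f 0) * max 0 (N z - real 0)
      + (\<Sum>k<K. second_diff f k * max 0 (N z - real (Suc k)))" for z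
  proof -
    define n where "n = nat (count_upto T x (z + a + r) - count_upto T x (z + a))"
    have n: "N z = real n"
      using count_upto_mono[of "z + a" "z + a + r" T x] r by (simp add: n_def N_def)
    have "real n \<le> real K"
      using count_upto_discrepancy[OF T, of r x "z + a"] n unfolding N_def K_def by linarith
    then show ?thesis
      using second_diff_expansion[of n K f] unfolding n by (simp add: f_def)
  qed
  have excess: "has_bochner_integral lborel (\<lambda>z. indicator {0..real T} z * max 0 (N z - real k))
      (pair_excess T x r k)" for k
    using has_bochner_integral_count_excess[OF x T, of a r k] by (simp add: N_def)
  have const: "has_bochner_integral lborel (indicator {0..real T}) (real T)"
    using has_bochner_integral_real_indicator[of "{0..real T}" lborel] by simp
  have "has_bochner_integral lborel (\<lambda>z. f 0 * indicator {0..real T} z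
      + (f 1 - f 0) * (indicator {0..real T} z * max 0 (N z - real 0))
      + (\<Sum>k<K. second_diff f k * (indicator {0..real T} z * max 0 (N z - real (Suc k)))))
     (f 0 * real T + (f 1 - f 0) * pair_excess T x r 0
      + (\<Sum>k<K. second_diff f k * pair_excess T x r (Suc k)))"
    by (intro has_bochner_integral_add has_bochner_integral_sum has_bochner_integral_mult_right excess const)
  also have "(\<lambda>z. f 0 * indicator {0..real T} z
      + (f 1 - f 0) * (indicator {0..real T} z * max 0 (N z - real 0))
      + (\<Sum>k<K. second_diff f k * (indicator {0..real T} z * max 0 (N z - real (Suc k)))))
     = (\<lambda>z. indicator {0..real T} z * \<bar>r - N z\<bar> powr p)"
    unfolding expand by (simp add: fun_eq_iff algebra_simps sum_distrib_left)
  also have "f 0 * real T + (f 1 - f 0) * pair_excess T x r 0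
      + (\<Sum>k<K. second_diff f k * pair_excess T x r (Suc k)) = window_energy p T x r"
    by (simp add: window_energy_def f_def[abs_def] K_def Let_def)
  finally show ?thesis by (simp add: N_def)
qed

text \<open>The average number of points in a window is \<open>r\<close> whatever the configuration,
  so the affine part of the expansion does not depend on \<open>x\<close>.\<close>

lemma pair_excess_0: "r \<ge> 0 \<Longrightarrow> pair_excess T x r 0 = real T * r"
  by (simp add: pair_excess_def)

lemma window_energy_nonneg:
  assumes "quasi_periodic T x" "T \<ge> 1" "r \<ge> 0"
  shows "window_energy p T x r \<ge> 0"
  unfolding has_bochner_integral_integral_eq[OF has_bochner_integral_window_energy[OF assms, of 0 p], symmetric]
  by (rule Bochner_Integration.integral_nonneg) simp

text \<open>The first bound is for small \<open>r\<close>: \<open>\<bar>r - N\<bar> powr p\<close>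
  is at most \<open>T powr (p - 1)\<close> times \<open>r + N\<close>, and \<open>N\<close>
  integrates to \<open>T r\<close>. The second is for large \<open>r\<close> and uses the
  discrepancy bound alone.\<close>

lemma window_energy_le:
  assumes x: "quasi_periodic T x" and T: "T \<ge> 1" and r: "r \<ge> 0" and p: "p \<ge> 1"
  shows "window_energy p T x r \<le> 2 * real T powr p * r"
    and "window_energy p T x r \<le> real T powr p * real T"
proof -
  define N where "N z = real_of_int (count_upto T x (z + 0 + r) - count_upto T x (z + 0))" for z
  have I: "has_bochner_integral lborel (\<lambda>z. indicator {0..real T} z * \<bar>r - N z\<bar> powr p) (window_energy p T x r)"
    using has_bochner_integral_window_energy[OF x T r, of 0 p] by (simp add: N_def)
  have disc: "\<bar>r - N z\<bar> \<le> real T" for z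
    using count_upto_discrepancy[OF T, of r x z] by (simp add: N_def)
  have N0: "N z \<ge> 0" for z
    using count_upto_mono[of z "z + r" T x] r by (simp add: N_def)
  have const: "has_bochner_integral lborel (indicator {0..real T}) (real T)"
    using has_bochner_integral_real_indicator[of "{0..real T}" lborel] by simp
  have IN: "has_bochner_integral lborel (\<lambda>z. indicator {0..real T} z * N z) (real T * r)"
    using has_bochner_integral_count_excess[OF x T, of 0 r 0] N0 pair_excess_0[OF r, of T x]
    by (simp add: N_def)
  have J: "has_bochner_integral lborel (\<lambda>z. real T powr (p - 1) * (r * indicator {0..real T} z + indicator {0..real T} z * N z))
     (real T powr (p - 1) * (r * real T + real T * r))"
    by (intro has_bochner_integral_add has_bochner_integral_mult_right IN const)
  from integrable.intros[OF I] integrable.intros[OF J]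
  have "(LBINT z. indicator {0..real T} z * \<bar>r - N z\<bar> powr p)
    \<le> (LBINT z. real T powr (p - 1) * (r * indicator {0..real T} z + indicator {0..real T} z * N z))"
  proof (rule integral_mono)
    fix z
    have "\<bar>r - N z\<bar> powr ((p - 1) + 1) = \<bar>r - N z\<bar> powr (p - 1) * \<bar>r - N z\<bar>"
      unfolding powr_add by simp
    also have "\<dots> \<le> real T powr (p - 1) * (r + N z)"
      using p disc[of z] N0[of z] r by (intro mult_mono powr_mono2) auto
    finally show "indicator {0..real T} z * \<bar>r - N z\<bar> powr p
      \<le> real T powr (p - 1) * (r * indicator {0..real T} z + indicator {0..real T} z * N z)"
      by (simp add: indicator_def algebra_simps)
  qed
  then have "window_energy p T x r \<le> 2 * (real T powr (p - 1) * real T powr 1) * r"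
    using I J
    by (simp add: has_bochner_integral_iff algebra_simps)
  then show "window_energy p T x r \<le> 2 * real T powr p * r"
    unfolding powr_add[symmetric] by simp
  have C: "has_bochner_integral lborel (\<lambda>z. real T powr p * indicator {0..real T} z) (real T powr p * real T)"
    by (intro has_bochner_integral_mult_right const)
  from integrable.intros[OF I] integrable.intros[OF C]
  have "(LBINT z. indicator {0..real T} z * \<bar>r - N z\<bar> powr p) \<le> (LBINT z. real T powr p * indicator {0..real T} z)"
    by (rule integral_mono) (use p disc in \<open>auto simp: indicator_def intro!: powr_mono2\<close>)
  then show "window_energy p T x r \<le> real T powr p * real T"
    using I C by (simp add: has_bochner_integral_iff)
qed

lemma nn_integral_window:
  assumes x: "quasi_periodic T x" and T: "T \<ge> 1"
  defines "U \<equiv> \<lambda>z. z - real_of_int (count_upto T x z)"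
  shows "(\<integral>\<^sup>+z. indicator {0..real T} z * ennreal (\<bar>U z - U (z + r)\<bar> powr p / \<bar>r\<bar> powr (1 + s * p)) \<partial>lborel)
    = ennreal (energy_density s p T x r)"
proof -
  \<comment> \<open>The left end of the window between \<open>z\<close> and \<open>z + r\<close>,
    relative to \<open>z\<close>, so that both signs of \<open>r\<close> reduce to a window of
    length \<open>\<bar>r\<bar>\<close>.\<close>
  define a where "a = min 0 r"
  have *: "\<bar>U z - U (z + r)\<bar> = \<bar>\<bar>r\<bar> - real_of_int (count_upto T x (z + a + \<bar>r\<bar>) - count_upto T x (z + a))\<bar>" for z
    by (auto simp: U_def a_def min_def)
  have "has_bochner_integral lborel (\<lambda>z. indicator {0..real T} z * \<bar>U z - U (z + r)\<bar> powr p / \<bar>r\<bar> powr (1 + s * p))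
    (energy_density s p T x r)"
    unfolding * energy_density_def
    by (intro has_bochner_integral_divide_zero has_bochner_integral_window_energy x T) auto
  then have "(\<integral>\<^sup>+z. ennreal (indicator {0..real T} z * \<bar>U z - U (z + r)\<bar> powr p / \<bar>r\<bar> powr (1 + s * p)) \<partial>lborel)
    = ennreal (energy_density s p T x r)"
    by (subst nn_integral_eq_integral) (auto simp: has_bochner_integral_iff)
  moreover have "ennreal (indicator {0..real T} z * v / w) = indicator {0..real T} z * ennreal (v / w)" for z v w
    by (simp add: indicator_def)
  ultimately show ?thesis by simp
qed

text \<open>Substitution \<open>y = z + r\<close> followed by Tonelli. Measurability of the density
  comes from the same parameter integral, not from its explicit formula.\<close>

lemma nn_integral_energy_density:
  assumes x: "quasi_periodic T x" and T: "T \<ge> 1"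
  defines "U \<equiv> \<lambda>z. z - real_of_int (count_upto T x z)"
  shows "(\<integral>\<^sup>+z. \<integral>\<^sup>+y. indicator {0..real T} z *
      ennreal (\<bar>U z - U y\<bar> powr p / \<bar>z - y\<bar> powr (1 + s * p)) \<partial>lborel \<partial>lborel)
    = (\<integral>\<^sup>+r. ennreal (energy_density s p T x r) \<partial>lborel)"
    and "energy_density s p T x \<in> borel_measurable borel"
proof -
  have U[measurable]: "U \<in> borel_measurable borel"
    unfolding U_def count_upto_def of_int_sum by measurable
  have "(\<integral>\<^sup>+y. indicator {0..real T} z *
      ennreal (\<bar>U z - U y\<bar> powr p / \<bar>z - y\<bar> powr (1 + s * p)) \<partial>lborel)
    = (\<integral>\<^sup>+r. indicator {0..real T} z *
      ennreal (\<bar>U z - U (z + r)\<bar> powr p / \<bar>r\<bar> powr (1 + s * p)) \<partial>lborel)" for z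
    by (subst nn_integral_real_affine[where c = 1 and t = z]) auto
  then have "(\<integral>\<^sup>+z. \<integral>\<^sup>+y. indicator {0..real T} z *
      ennreal (\<bar>U z - U y\<bar> powr p / \<bar>z - y\<bar> powr (1 + s * p)) \<partial>lborel \<partial>lborel)
    = (\<integral>\<^sup>+z. \<integral>\<^sup>+r. indicator {0..real T} z *
      ennreal (\<bar>U z - U (z + r)\<bar> powr p / \<bar>r\<bar> powr (1 + s * p)) \<partial>lborel \<partial>lborel)"
    by simp
  also have "\<dots> = (\<integral>\<^sup>+r. \<integral>\<^sup>+z. indicator {0..real T} z *
      ennreal (\<bar>U z - U (z + r)\<bar> powr p / \<bar>r\<bar> powr (1 + s * p)) \<partial>lborel \<partial>lborel)"
    by (intro lborel_pair.Fubini') measurable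
  also have "\<dots> = (\<integral>\<^sup>+r. ennreal (energy_density s p T x r) \<partial>lborel)"
    using nn_integral_window[OF x T] by (simp add: U_def)
  finally show "(\<integral>\<^sup>+z. \<integral>\<^sup>+y. indicator {0..real T} z *
      ennreal (\<bar>U z - U y\<bar> powr p / \<bar>z - y\<bar> powr (1 + s * p)) \<partial>lborel \<partial>lborel)
    = (\<integral>\<^sup>+r. ennreal (energy_density s p T x r) \<partial>lborel)" .
  have "(\<lambda>r. enn2real (\<integral>\<^sup>+z. indicator {0..real T} z *
      ennreal (\<bar>U z - U (z + r)\<bar> powr p / \<bar>r\<bar> powr (1 + s * p)) \<partial>lborel)) \<in> borel_measurable borel"
    by measurable
  also have "(\<lambda>r. enn2real (\<integral>\<^sup>+z. indicator {0..real T} z *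
      ennreal (\<bar>U z - U (z + r)\<bar> powr p / \<bar>r\<bar> powr (1 + s * p)) \<partial>lborel)) = energy_density s p T x"
    using nn_integral_window[OF x T] window_energy_nonneg[OF x T]
    by (auto simp: U_def energy_density_def)
  finally show "energy_density s p T x \<in> borel_measurable borel" .
qed

section \<open>Finiteness of the energy\<close>

lemma integrable_lborel_nonneg:
  fixes f :: "real \<Rightarrow> real"
  assumes "f integrable_on S" "\<And>z. z \<in> S \<Longrightarrow> f z \<ge> 0" "(\<lambda>z. indicator S z * f z) \<in> borel_measurable borel"
  shows "integrable lborel (\<lambda>z. indicator S z * f z)"
proof -
  have "f absolutely_integrable_on S" using assms(1,2) by (rule nonnegative_absolutely_integrable_1)
  then have "integrable (completion lborel) (\<lambda>z. indicator S z * f z)" by (simp add: set_integrable_def)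
  then show ?thesis using assms(3) by (subst (asm) integrable_completion) auto
qed

lemma integrable_energy_density:
  assumes x: "quasi_periodic T x" and T: "T \<ge> 1" and sp: "p \<ge> 1" "0 < s" "s * p < 1"
  shows "integrable lborel (energy_density s p T x)"
proof -
  \<comment> \<open>Near 0 the linear bound leaves the power \<open>- (s * p)\<close>, integrable
    since \<open>s * p < 1\<close>; beyond 1 the constant bound leaves \<open>- (1 + s * p)\<close>,
    integrable since \<open>s * p > 0\<close>.\<close>
  define h where "h z = indicator {0..1} z * z powr (- (s * p)) + indicator {1..} z * z powr (- (1 + s * p))" for z :: real
  have sp0: "s * p > 0" using sp by simp
  have h: "integrable lborel h" unfolding h_def
  proof (intro Bochner_Integration.integrable_add integrable_lborel_nonneg)
    show "(\<lambda>z::real. z powr (- (s * p))) integrable_on {0..1}"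
      by (rule integrable_on_powr_from_0) (use sp in auto)
    show "(\<lambda>z::real. z powr (- (1 + s * p))) integrable_on {1..}"
      using has_integral_powr_to_inf[of "- (1 + s * p)" 1] sp0 by (auto simp: integrable_on_def)
  qed auto
  have "integrable lborel (\<lambda>z. h (0 + (- 1) * z))"
    by (rule lborel_integrable_real_affine[OF h]) simp
  then have h': "integrable lborel (\<lambda>z. h z + h (- z))" using h by simp
  define C where "C = max (2 * real T powr p) (real T powr p * real T)"
  have C: "C \<ge> 0" by (simp add: C_def le_max_iff_disj)
  have hnn: "h z \<ge> 0" for z by (simp add: h_def)
  have bound: "energy_density s p T x z \<le> C * h \<bar>z\<bar>" for z
  proof -
    consider "z = 0" | "0 < \<bar>z\<bar>" "\<bar>z\<bar> \<le> 1" | "\<bar>z\<bar> > 1" by linarith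
    then show ?thesis
    proof cases
      case 2
      have "window_energy p T x \<bar>z\<bar> \<le> C * \<bar>z\<bar>"
        using window_energy_le(1)[OF x T, of "\<bar>z\<bar>" p] sp mult_right_mono[of "2 * real T powr p" C "\<bar>z\<bar>"]
        by (simp add: C_def)
      then have "energy_density s p T x z \<le> C * \<bar>z\<bar> / \<bar>z\<bar> powr (1 + s * p)"
        unfolding energy_density_def by (rule divide_right_mono) simp
      also have "\<dots> = C * \<bar>z\<bar> powr (- (s * p))"
        using 2 by (simp add: powr_add powr_minus field_simps)
      also have "\<dots> \<le> C * h \<bar>z\<bar>"
        using 2 C by (intro mult_left_mono) (auto simp: h_def)
      finally show ?thesis .
    next
      case 3
      have "window_energy p T x \<bar>z\<bar> \<le> C"
        using window_energy_le(2)[OF x T, of "\<bar>z\<bar>" p] sp by (simp add: C_def)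
      then have "energy_density s p T x z \<le> C / \<bar>z\<bar> powr (1 + s * p)"
        unfolding energy_density_def by (rule divide_right_mono) simp
      also have "\<dots> = C * \<bar>z\<bar> powr (- (1 + s * p))"
        by (subst powr_minus_divide) simp
      also have "\<dots> \<le> C * h \<bar>z\<bar>"
        using 3 C by (intro mult_left_mono) (auto simp: h_def)
      finally show ?thesis .
    qed (use C hnn in \<open>simp add: energy_density_def\<close>)
  qed
  have "integrable lborel (\<lambda>z. C * (h z + h (- z)))" using h' by simp
  then show ?thesis
  proof (rule Bochner_Integration.integrable_bound)
    show "energy_density s p T x \<in> borel_measurable lborel"
      using nn_integral_energy_density(2)[OF x T] by simp
    have "norm (energy_density s p T x z) \<le> norm (C * (h z + h (- z)))" for z
    proof -
      have "energy_density s p T x z \<ge> 0"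
        using window_energy_nonneg[OF x T] by (simp add: energy_density_def)
      moreover have "C * h \<bar>z\<bar> \<le> C * (h z + h (- z))"
        using C hnn by (intro mult_left_mono) (auto simp: abs_if)
      ultimately show ?thesis using bound[of z] by simp
    qed
    then show "AE z in lborel. norm (energy_density s p T x z) \<le> norm (C * (h z + h (- z)))" by simp
  qed
qed

lemma energy_eq_nn_integral:
  assumes x: "quasi_periodic T x" and T: "T \<ge> 1" and sp: "p \<ge> 1" "0 < s" "s * p < 1"
  defines "U \<equiv> \<lambda>z. z - real_of_int (count_upto T x z)"
  shows "enn2real (\<integral>\<^sup>+z. \<integral>\<^sup>+y. indicator {0..real T} z *
      ennreal (\<bar>U z - U y\<bar> powr p / \<bar>z - y\<bar> powr (1 + s * p)) \<partial>lborel \<partial>lborel) = energy s p T x"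
proof -
  have nn: "energy_density s p T x z \<ge> 0" for z
    using window_energy_nonneg[OF x T] by (simp add: energy_density_def)
  have "(\<integral>\<^sup>+r. ennreal (energy_density s p T x r) \<partial>lborel) = ennreal (energy s p T x)"
    unfolding energy_def using nn by (intro nn_integral_eq_integral integrable_energy_density x T sp) auto
  moreover have "energy s p T x \<ge> 0"
    unfolding energy_def using nn by (rule Bochner_Integration.integral_nonneg)
  ultimately show ?thesis
    using nn_integral_energy_density(1)[OF x T] by (simp add: U_def)
qed

subsection \<open>Minimality of equispaced sequences\<close>

definition equally_spaced :: "(int \<Rightarrow> real) \<Rightarrow> bool" where
  "equally_spaced x \<longleftrightarrow> (\<forall>j. x (j + 1) = x j + 1)"

lemma powr_midpoint_le:
  fixes a b p :: real
  assumes "a \<ge> 0" "b \<ge> 0" "p \<ge> 1"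
  shows "2 * ((a + b) / 2) powr p \<le> a powr p + b powr p"
proof -
  have half: "2 * (c / 2) powr p \<le> c powr p" if "c \<ge> 0" for c :: real
  proof -
    have "(2::real) powr 1 \<le> 2 powr p" using assms by (intro powr_mono) auto
    then show ?thesis using that mult_right_mono[of 2 "2 powr p" "c powr p"]
      by (simp add: powr_divide field_simps)
  qed
  show ?thesis
  proof (cases "a = 0 \<or> b = 0")
    case True
    then show ?thesis using half[of a] half[of b] assms by auto
  next
    case False
    then show ?thesis
      using convex_onD[OF powr_convex[OF assms(3)], of "1/2" a b] assms
      by (simp add: field_simps)
  qed
qed

text \<open>By the triangle inequality the middle distance is at most the mean of the outer two;
  then monotonicity and midpoint convexity of the power apply.\<close>

lemma second_diff_powr_nonneg:
  assumes "p \<ge> 1"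
  shows "second_diff (\<lambda>n. \<bar>r - real n\<bar> powr p) k \<ge> 0"
proof -
  have "2 * \<bar>r - real (Suc k)\<bar> powr p
    \<le> 2 * ((\<bar>r - real k\<bar> + \<bar>r - real (Suc (Suc k))\<bar>) / 2) powr p"
  proof (intro mult_left_mono powr_mono2)
    show "\<bar>r - real (Suc k)\<bar> \<le> (\<bar>r - real k\<bar> + \<bar>r - real (Suc (Suc k))\<bar>) / 2"
      unfolding of_nat_Suc by argo
  qed (use assms in auto)
  also have "\<dots> \<le> \<bar>r - real k\<bar> powr p + \<bar>r - real (Suc (Suc k))\<bar> powr p"
    using assms by (intro powr_midpoint_le) auto
  finally show ?thesis by (simp add: second_diff_def)
qed

text \<open>The outer distances \<open>r\<close> and \<open>2 - r\<close> have mean 1, so their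
  powers sum to at least 2, while the middle distance is strictly below 1. Hence the sign is strict
  even at \<open>p = 1\<close>.\<close>

lemma second_diff_powr_pos:
  assumes "p \<ge> 1" "0 < r" "r < 2"
  shows "second_diff (\<lambda>n. \<bar>r - real n\<bar> powr p) 0 > 0"
proof -
  have "2 * \<bar>r - 1\<bar> powr p < 2"
    using assms powr_less_mono2[of p "\<bar>r - 1\<bar>" 1] by simp
  also have "\<dots> \<le> r powr p + (2 - r) powr p"
    using powr_midpoint_le[of r "2 - r" p] assms by simp
  finally show ?thesis using assms by (simp add: second_diff_def)
qed

text \<open>A bound uniform in \<open>r\<close> and \<open>k\<close>, but only near the kink: a
  small displacement of an equispaced sequence affects no other kinks.\<close>

lemma second_diff_powr_le:
  assumes "p \<ge> 1" "\<bar>r - real (Suc k)\<bar> < 1 / 2"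
  shows "second_diff (\<lambda>n. \<bar>r - real n\<bar> powr p) k \<le> 2 * 2 powr p"
proof -
  have "\<bar>r - real k\<bar> powr p \<le> 2 powr p" "\<bar>r - real (Suc (Suc k))\<bar> powr p \<le> 2 powr p"
    using assms by (intro powr_mono2; linarith)+
  moreover have "\<bar>r - real (Suc k)\<bar> powr p \<ge> 0" by simp
  ultimately show ?thesis unfolding second_diff_def by linarith
qed

text \<open>The affine parts cancel, so two configurations can be compared lag by lag with
  nonnegative coefficients.\<close>

lemma window_energy_diff:
  assumes "r \<ge> 0"
  shows "window_energy p T x r - window_energy p T y r =
    (\<Sum>k<nat \<lceil>r\<rceil> + T. second_diff (\<lambda>n. \<bar>r - real n\<bar> powr p) k
        * (pair_excess T x r (Suc k) - pair_excess T y r (Suc k)))"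
  using assms by (simp add: window_energy_def pair_excess_0 sum_subtractf algebra_simps)

lemma energy_density_diff:
  "energy_density s p T x r - energy_density s p T y r =
    (window_energy p T x \<bar>r\<bar> - window_energy p T y \<bar>r\<bar>) / \<bar>r\<bar> powr (1 + s * p)"
  by (simp add: energy_density_def diff_divide_distrib)

lemma equally_spaced_add:
  assumes "equally_spaced x"
  shows "x (j + int k) = x j + real k"
proof (induction k)
  case (Suc k)
  have "x (j + int (Suc k)) = x ((j + int k) + 1)" by (simp add: algebra_simps)
  then show ?case using assms Suc by (simp add: equally_spaced_def)
qed simp

lemma mono_int_iff: "mono (x :: int \<Rightarrow> real) \<longleftrightarrow> (\<forall>j. x j \<le> x (j + 1))"
proof
  assume step: "\<forall>j. x j \<le> x (j + 1)"
  have "x i \<le> x j" if "i \<le> j" for i j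
    using that by (induction j rule: int_ge_induct) (use step order_trans in blast)+
  then show "mono x" by (simp add: mono_def)
qed (simp add: mono_def)

lemma quasi_periodic_equally_spaced:
  assumes "equally_spaced x"
  shows "quasi_periodic T x"
  using assms equally_spaced_add[OF assms, of _ T]
  by (auto simp: quasi_periodic_def mono_int_iff equally_spaced_def)

text \<open>The gaps over a period add up to \<open>T\<close>, so a one-sided bound by 1 on all of
  them leaves no room for a different value.\<close>

lemma equally_spaced_gaps:
  assumes x: "quasi_periodic T x" and "T \<ge> 1"
    and "(\<forall>j. x (j + 1) - x j \<le> 1) \<or> (\<forall>j. x (j + 1) - x j \<ge> 1)"
  shows "equally_spaced x"
  unfolding equally_spaced_def
proof
  fix j
  have shift: "x (j + int T) = x j + real T" by (rule quasi_periodicD(2)[OF x])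
  have T: "int T = 1 + int (T - 1)" "real T = 1 + real (T - 1)" using \<open>T \<ge> 1\<close> by auto
  from assms(3) show "x (j + 1) = x j + 1"
  proof
    assume g: "\<forall>j. x (j + 1) - x j \<le> 1"
    have "x (j + 1 + int m) \<le> x (j + 1) + real m" for m
    proof (induction m)
      case (Suc m)
      show ?case using g[rule_format, of "j + 1 + int m"] Suc by (simp add: algebra_simps)
    qed simp
    from this[of "T - 1"] shift g[rule_format, of j] show ?thesis
      unfolding T by (simp add: algebra_simps)
  next
    assume g: "\<forall>j. x (j + 1) - x j \<ge> 1"
    have "x (j + 1 + int m) \<ge> x (j + 1) + real m" for m
    proof (induction m)
      case (Suc m)
      show ?case using g[rule_format, of "j + 1 + int m"] Suc by (simp add: algebra_simps)
    qed simp
    from this[of "T - 1"] shift g[rule_format, of j] show ?thesis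
      unfolding T by (simp add: algebra_simps)
  qed
qed

lemma quasi_periodic_gap_mod:
  assumes x: "quasi_periodic T x"
  shows "x (j + 1) - x j = x (j mod int T + 1) - x (j mod int T)"
proof -
  have "x (j + c) = x (j mod int T + c) + real_of_int (j div int T) * real T" for c
    using quasi_periodic_add_mult[OF x, of "j mod int T + c" "j div int T"]
    by (metis add.assoc add.commute mod_mult_div_eq mult.commute)
  from this[of 0] this[of 1] show ?thesis by simp
qed

lemma pair_excess_equally_spaced:
  "equally_spaced x \<Longrightarrow> pair_excess T x r k = real T * max 0 (r - real k)"
  by (simp add: pair_excess_def equally_spaced_add)

lemma sum_gap_slack:
  assumes "quasi_periodic T x"
  shows "(\<Sum>i<T. r - (x (int i + int k) - x (int i))) = real T * (r - real k)"
  unfolding sum_subtractf[of "\<lambda>_. r"] sum_gaps[OF assms] by (simp add: algebra_simps)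

text \<open>Jensen in elementary form: a sum of positive parts dominates the positive part of the
  sum, and that sum is the same for all \<open>x\<close>.\<close>

lemma pair_excess_ge:
  assumes "quasi_periodic T x"
  shows "real T * max 0 (r - real k) \<le> pair_excess T x r k"
proof -
  have "(\<Sum>i<T. r - (x (int i + int k) - x (int i))) \<le> pair_excess T x r k"
    unfolding pair_excess_def by (intro sum_mono) simp
  moreover have "pair_excess T x r k \<ge> 0"
    unfolding pair_excess_def by (intro sum_nonneg) simp
  ultimately show ?thesis
    unfolding sum_gap_slack[OF assms] by (simp add: max_def)
qed

text \<open>Here \<open>a\<close> is an adjacent gap below 1 and \<open>b\<close> one above 1. For
  \<open>r\<close> between them the slacks take both signs, which makes Jensen strict. A whole
  interval is provided because the energy only sees sets of positive measure.\<close>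

lemma pair_excess_1_greater:
  assumes x: "quasi_periodic T x" and T: "T \<ge> 1" and ne: "\<not> equally_spaced x"
  obtains a b where "0 \<le> a" "a < 1" "1 < b"
    "\<And>r. a < r \<Longrightarrow> r < b \<Longrightarrow> real T * max 0 (r - 1) < pair_excess T x r 1"
proof -
  define d where "d j = x (j + 1) - x j" for j
  have red: "\<exists>i<T. d j = d (int i)" for j
  proof (intro exI conjI)
    show "nat (j mod int T) < T" using T by (simp add: nat_less_iff)
    show "d j = d (int (nat (j mod int T)))"
      using quasi_periodic_gap_mod[OF x, of j] T by (simp add: d_def)
  qed
  have "\<not> (\<forall>j. d j \<le> 1)" "\<not> (\<forall>j. d j \<ge> 1)"
    using ne equally_spaced_gaps[OF x T] by (auto simp: d_def)
  then obtain j1 j2 where "d j1 < 1" "d j2 > 1" by (auto simp: not_le)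
  then obtain i1 i2 where i: "i1 < T" "i2 < T" "d (int i1) < 1" "d (int i2) > 1"
    using red by metis
  show thesis
  proof (rule that)
    show "0 \<le> d (int i1)" using quasi_periodicD(1)[OF x] by (simp add: d_def)
    show "d (int i1) < 1" "1 < d (int i2)" using i by auto
    fix r assume r: "d (int i1) < r" "r < d (int i2)"
    have "(\<Sum>i<T. r - d (int i)) < (\<Sum>i<T. max 0 (r - d (int i)))"
      using i r by (intro sum_strict_mono_ex1) (auto intro!: bexI[of _ i2])
    moreover have "(\<Sum>i<T. r - d (int i)) = real T * (r - 1)"
      using sum_gap_slack[OF x, of r 1] by (simp add: d_def)
    moreover have "0 < (\<Sum>i<T. max 0 (r - d (int i)))"
      using i r by (intro sum_pos2[of _ i1]) auto
    ultimately show "real T * max 0 (r - 1) < pair_excess T x r 1"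
      by (simp add: pair_excess_def d_def max_def)
  qed
qed

lemma window_energy_minimal:
  assumes "quasi_periodic T x" "equally_spaced y" "p \<ge> 1" "r \<ge> 0"
  shows "window_energy p T y r \<le> window_energy p T x r"
proof -
  have "0 \<le> window_energy p T x r - window_energy p T y r"
    unfolding window_energy_diff[OF assms(4)] pair_excess_equally_spaced[OF assms(2)]
    using assms pair_excess_ge[OF assms(1)] second_diff_powr_nonneg[OF assms(3)]
    by (intro sum_nonneg mult_nonneg_nonneg) (simp_all del: of_nat_Suc)
  then show ?thesis by simp
qed

lemma window_energy_strictly_minimal:
  assumes x: "quasi_periodic T x" and y: "equally_spaced y" and p: "p \<ge> 1"
    and r: "0 < r" "r < 2" and T: "T \<ge> 1"
    and less: "real T * max 0 (r - 1) < pair_excess T x r 1"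
  shows "window_energy p T y r < window_energy p T x r"
proof -
  have "0 < window_energy p T x r - window_energy p T y r"
    unfolding window_energy_diff[OF less_imp_le[OF r(1)]] pair_excess_equally_spaced[OF y]
  proof (rule sum_pos2[of _ 0])
    show "0 < second_diff (\<lambda>n. \<bar>r - real n\<bar> powr p) 0 *
        (pair_excess T x r (Suc 0) - real T * max 0 (r - real (Suc 0)))"
      using second_diff_powr_pos[OF p r] less by (intro mult_pos_pos) auto
    show "0 \<le> second_diff (\<lambda>n. \<bar>r - real n\<bar> powr p) k *
        (pair_excess T x r (Suc k) - real T * max 0 (r - real (Suc k)))" for k
      using pair_excess_ge[OF x] second_diff_powr_nonneg[OF p]
      by (intro mult_nonneg_nonneg) (simp_all del: of_nat_Suc)
  qed (use T in auto)
  then show ?thesis by simp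
qed

lemma energy_minimal:
  assumes x: "quasi_periodic T x" and y: "equally_spaced y"
    and T: "T \<ge> 1" and sp: "p \<ge> 1" "0 < s" "s * p < 1"
  shows "energy s p T y \<le> energy s p T x"
  unfolding energy_def energy_density_def[abs_def]
proof (rule integral_mono)
  show "window_energy p T y \<bar>r\<bar> / \<bar>r\<bar> powr (1 + s * p)
    \<le> window_energy p T x \<bar>r\<bar> / \<bar>r\<bar> powr (1 + s * p)" for r
    using window_energy_minimal[OF x y sp(1)] by (intro divide_right_mono) auto
qed (use integrable_energy_density[unfolded energy_density_def[abs_def]] x
      quasi_periodic_equally_spaced[OF y] T sp in auto)

lemma energy_strictly_minimal:
  assumes x: "quasi_periodic T x" and y: "equally_spaced y" and ne: "\<not> equally_spaced x"
    and T: "T \<ge> 1" and sp: "p \<ge> 1" "0 < s" "s * p < 1"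
  shows "energy s p T y < energy s p T x"
proof (rule ccontr)
  assume "\<not> energy s p T y < energy s p T x"
  with energy_minimal[OF x y T sp] have eq: "energy s p T x - energy s p T y = 0" by simp
  note int = integrable_energy_density[OF x T sp]
    integrable_energy_density[OF quasi_periodic_equally_spaced[OF y] T sp]
  define D where "D r = energy_density s p T x r - energy_density s p T y r" for r
  have "integrable lborel D" unfolding D_def[abs_def] using int by simp
  moreover have "D r \<ge> 0" for r
    using window_energy_minimal[OF x y sp(1)]
    unfolding D_def energy_density_diff by (intro divide_nonneg_nonneg) auto
  moreover have "(LBINT r. D r) = 0"
    using eq int by (simp add: D_def energy_def)
  ultimately have zero: "AE r in lborel. D r = 0"
    using integral_nonneg_eq_0_iff_AE[of lborel D] by simp
  obtain a b where ab: "0 \<le> a" "a < 1" "1 < b"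
    "\<And>r. a < r \<Longrightarrow> r < b \<Longrightarrow> real T * max 0 (r - 1) < pair_excess T x r 1"
    using pair_excess_1_greater[OF x T ne] by blast
  \<comment> \<open>The cap at 2 keeps the coefficient of the adjacent-point term positive.\<close>
  have pos: "D r > 0" if "a < r" "r < min b 2" for r
    using window_energy_strictly_minimal[OF x y sp(1) _ _ T ab(4)] that ab
    unfolding D_def energy_density_diff by (intro divide_pos_pos) auto
  from zero have "AE r in lborel. r \<notin> {a<..<min b 2}"
    by eventually_elim (metis pos greaterThanLessThan_iff less_irrefl)
  then have "{a<..<min b 2} \<in> null_sets lborel"
    by (subst AE_iff_null_sets) auto
  then show False using ab by (auto simp: null_sets_def min_def split: if_splits)
qed

subsection \<open>Convexity of the energy\<close>

text \<open>Stated for finite families because the argument for critical points mixes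
  \<open>T + 1\<close> sequences at once.\<close>

lemma quasi_periodic_convex_combination:
  assumes "\<And>a. a \<in> A \<Longrightarrow> quasi_periodic T (x a)" "\<And>a. a \<in> A \<Longrightarrow> w a \<ge> 0" "sum w A = 1"
  shows "quasi_periodic T (\<lambda>j. \<Sum>a\<in>A. w a * x a j)"
  unfolding quasi_periodic_def
proof (intro conjI allI)
  show "mono (\<lambda>j. \<Sum>a\<in>A. w a * x a j)"
    using assms by (auto simp: mono_def quasi_periodic_def intro!: sum_mono mult_left_mono)
  fix j
  have "(\<Sum>a\<in>A. w a * x a (j + int T)) = (\<Sum>a\<in>A. w a * x a j + w a * real T)"
    using assms(1) by (intro sum.cong) (auto simp: quasi_periodic_def algebra_simps)
  then show "(\<Sum>a\<in>A. w a * x a (j + int T)) = (\<Sum>a\<in>A. w a * x a j) + real T"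
    using assms(3) by (simp add: sum.distrib sum_distrib_right[symmetric])
qed

text \<open>Each summand is the positive part of an affine function of the sequence.\<close>

lemma pair_excess_convex:
  assumes "finite A" "\<And>a. a \<in> A \<Longrightarrow> w a \<ge> 0" "sum w A = 1"
  shows "pair_excess T (\<lambda>j. \<Sum>a\<in>A. w a * x a j) r k \<le> (\<Sum>a\<in>A. w a * pair_excess T (x a) r k)"
proof -
  have "max 0 (r - ((\<Sum>a\<in>A. w a * x a (int i + int k)) - (\<Sum>a\<in>A. w a * x a (int i))))
     \<le> (\<Sum>a\<in>A. w a * max 0 (r - (x a (int i + int k) - x a (int i))))" for i
  proof -
    have "r = (\<Sum>a\<in>A. w a * r)" using assms(3) by (simp add: sum_distrib_right[symmetric])
    then have "r - ((\<Sum>a\<in>A. w a * x a (int i + int k)) - (\<Sum>a\<in>A. w a * x a (int i)))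
      = (\<Sum>a\<in>A. w a * (r - (x a (int i + int k) - x a (int i))))"
      by (simp add: algebra_simps sum_subtractf sum.distrib)
    also have "\<dots> \<le> (\<Sum>a\<in>A. w a * max 0 (r - (x a (int i + int k) - x a (int i))))"
      using assms by (intro sum_mono mult_left_mono) auto
    finally show ?thesis using assms by (auto intro!: sum_nonneg)
  qed
  then have "pair_excess T (\<lambda>j. \<Sum>a\<in>A. w a * x a j) r k
    \<le> (\<Sum>i<T. \<Sum>a\<in>A. w a * max 0 (r - (x a (int i + int k) - x a (int i))))"
    unfolding pair_excess_def by (intro sum_mono)
  also have "\<dots> = (\<Sum>a\<in>A. w a * pair_excess T (x a) r k)"
    unfolding pair_excess_def sum_distrib_left by (rule sum.swap)
  finally show ?thesis .
qed

text \<open>The coefficient \<open>f 1 - f 0\<close> may be negative; this is harmless because the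
  lag-0 excess it multiplies is constant. All other coefficients are nonnegative second
  differences.\<close>

lemma window_energy_convex:
  assumes A: "finite A" "\<And>a. a \<in> A \<Longrightarrow> w a \<ge> 0" "sum w A = 1" and p: "p \<ge> 1" and r: "r \<ge> 0"
  shows "window_energy p T (\<lambda>j. \<Sum>a\<in>A. w a * x a j) r \<le> (\<Sum>a\<in>A. w a * window_energy p T (x a) r)"
proof -
  define f where "f n = \<bar>r - real n\<bar> powr p" for n
  define K where "K = nat \<lceil>r\<rceil> + T"
  have we: "window_energy p T y r = f 0 * real T + (f 1 - f 0) * (real T * r)
      + (\<Sum>k<K. second_diff f k * pair_excess T y r (Suc k))" for y
    by (simp add: window_energy_def f_def[abs_def] K_def Let_def pair_excess_0[OF r])
  have c: "(\<Sum>a\<in>A. w a * c) = c" for c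
    using A(3) by (simp add: sum_distrib_right[symmetric])
  have "window_energy p T (\<lambda>j. \<Sum>a\<in>A. w a * x a j) r \<le> f 0 * real T + (f 1 - f 0) * (real T * r)
      + (\<Sum>k<K. second_diff f k * (\<Sum>a\<in>A. w a * pair_excess T (x a) r (Suc k)))"
    unfolding we using second_diff_powr_nonneg[OF p, of r]
    by (intro add_left_mono sum_mono mult_left_mono pair_excess_convex A) (auto simp: f_def[abs_def])
  also have "(\<Sum>k<K. second_diff f k * (\<Sum>a\<in>A. w a * pair_excess T (x a) r (Suc k)))
     = (\<Sum>a\<in>A. w a * (\<Sum>k<K. second_diff f k * pair_excess T (x a) r (Suc k)))"
    unfolding sum_distrib_left by (subst sum.swap) (simp add: mult_ac)
  also have "f 0 * real T + (f 1 - f 0) * (real T * r) + \<dots> = (\<Sum>a\<in>A. w a * window_energy p T (x a) r)"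
    unfolding we distrib_left sum.distrib c by simp
  finally show ?thesis .
qed

lemma energy_convex:
  assumes A: "finite A" "\<And>a. a \<in> A \<Longrightarrow> w a \<ge> 0" "sum w A = 1"
    and x: "\<And>a. a \<in> A \<Longrightarrow> quasi_periodic T (x a)"
    and T: "T \<ge> 1" and sp: "p \<ge> 1" "0 < s" "s * p < 1"
  shows "energy s p T (\<lambda>j. \<Sum>a\<in>A. w a * x a j) \<le> (\<Sum>a\<in>A. w a * energy s p T (x a))"
proof -
  have int: "integrable lborel (energy_density s p T (x a))" if "a \<in> A" for a
    using integrable_energy_density[OF x[OF that] T sp] .
  have "energy s p T (\<lambda>j. \<Sum>a\<in>A. w a * x a j) \<le> (LBINT r. \<Sum>a\<in>A. w a * energy_density s p T (x a) r)"
    unfolding energy_def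
  proof (rule integral_mono)
    show "integrable lborel (energy_density s p T (\<lambda>j. \<Sum>a\<in>A. w a * x a j))"
      using x A by (intro integrable_energy_density quasi_periodic_convex_combination T sp) auto
    show "integrable lborel (\<lambda>r. \<Sum>a\<in>A. w a * energy_density s p T (x a) r)"
      using int by (intro Bochner_Integration.integrable_sum integrable_mult_right) auto
    show "energy_density s p T (\<lambda>j. \<Sum>a\<in>A. w a * x a j) r \<le> (\<Sum>a\<in>A. w a * energy_density s p T (x a) r)" for r
      using divide_right_mono[OF window_energy_convex[OF A sp(1), of "\<bar>r\<bar>" T x], of "\<bar>r\<bar> powr (1 + s * p)"]
      by (simp add: energy_density_def sum_divide_distrib)
  qed
  also have "\<dots> = (\<Sum>a\<in>A. w a * energy s p T (x a))"
    unfolding energy_def using int by (subst Bochner_Integration.integral_sum) auto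
  finally show ?thesis .
qed

subsection \<open>Displacing a single point\<close>

definition displace :: "nat \<Rightarrow> nat \<Rightarrow> real \<Rightarrow> (int \<Rightarrow> real) \<Rightarrow> int \<Rightarrow> real" where
  "displace T i h x j = x j + (if j mod int T = int i then h else 0)"

lemma quasi_periodic_displace:
  assumes x: "quasi_periodic T x" and gap: "\<And>j. \<bar>h\<bar> \<le> (x (j + 1) - x j) / 2"
  shows "quasi_periodic T (displace T i h x)"
proof -
  have "displace T i h x j \<le> displace T i h x (j + 1)" for j
    using gap[of j] by (auto simp: displace_def)
  moreover have "displace T i h x (j + int T) = displace T i h x j + real T" for j
    by (simp add: displace_def quasi_periodicD(2)[OF x])
  ultimately show ?thesis by (simp add: quasi_periodic_def mono_int_iff)
qed

text \<open>The displaced lag-\<open>k\<close> gaps lie within \<open>\<bar>h\<bar>\<close> of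
  \<open>k\<close> and still average to \<open>k\<close>. If \<open>r\<close> is farther than that
  from \<open>k\<close>, all slacks have one sign and the sum of positive parts is unchanged;
  otherwise each of the \<open>T\<close> terms grows by at most
  \<open>\<bar>h\<bar>\<close>.\<close>

lemma pair_excess_displace_le:
  assumes x: "equally_spaced x" and h: "\<bar>h\<bar> < 1 / 2"
  shows "pair_excess T (displace T i h x) r k - pair_excess T x r k
    \<le> (if \<bar>r - real k\<bar> < \<bar>h\<bar> then real T * \<bar>h\<bar> else 0)"
proof -
  define y where "y = displace T i h x"
  have y: "quasi_periodic T y" unfolding y_def
    using x h by (intro quasi_periodic_displace quasi_periodic_equally_spaced) (auto simp: equally_spaced_def)
  define d where "d l = y (int l + int k) - y (int l)" for l
  have d: "\<bar>d l - real k\<bar> \<le> \<bar>h\<bar>" for l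
    using equally_spaced_add[OF x] by (auto simp: d_def y_def displace_def)
  have slack: "(\<Sum>l<T. r - d l) = real T * (r - real k)"
    unfolding d_def by (rule sum_gap_slack[OF y])
  have pe: "pair_excess T y r k = (\<Sum>l<T. max 0 (r - d l))" by (simp add: pair_excess_def d_def)
  consider "r - real k \<ge> \<bar>h\<bar>" | "real k - r \<ge> \<bar>h\<bar>" | "\<bar>r - real k\<bar> < \<bar>h\<bar>" by linarith
  then have "pair_excess T y r k - real T * max 0 (r - real k)
    \<le> (if \<bar>r - real k\<bar> < \<bar>h\<bar> then real T * \<bar>h\<bar> else 0)"
  proof cases
    case 1
    then have "r - real k \<ge> 0" by linarith
    moreover have "max 0 (r - d l) = r - d l" for l using d[of l] 1 by (simp add: max_def)
    ultimately show ?thesis using slack unfolding pe by (simp add: max_absorb2)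
  next
    case 2
    have "max 0 (r - d l) = 0" for l using d[of l] 2 by linarith
    moreover have "0 \<le> real T * max 0 (r - real k)" by (intro mult_nonneg_nonneg) auto
    ultimately show ?thesis unfolding pe by (auto intro: order_trans[of _ 0])
  next
    case 3
    have "(\<Sum>l<T. max 0 (r - d l)) \<le> (\<Sum>l<T. max 0 (r - real k) + \<bar>h\<bar>)"
    proof (rule sum_mono)
      fix l show "max 0 (r - d l) \<le> max 0 (r - real k) + \<bar>h\<bar>" using d[of l] by linarith
    qed
    then show ?thesis using 3 unfolding pe by (simp add: algebra_simps)
  qed
  then show ?thesis by (simp add: y_def pair_excess_equally_spaced[OF x])
qed

text \<open>Neighbourhoods of radius \<open>\<bar>h\<bar> < 1 / 2\<close> around distinct integers
  are disjoint, so at most one kink is affected and the bound does not grow with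
  \<open>r\<close>.\<close>

lemma window_energy_displace_le:
  assumes x: "equally_spaced x" and h: "\<bar>h\<bar> < 1 / 2" and p: "p \<ge> 1" and r: "r \<ge> 0"
  shows "window_energy p T (displace T i h x) r - window_energy p T x r
    \<le> (if \<exists>k. \<bar>r - real (Suc k)\<bar> < \<bar>h\<bar> then 2 * 2 powr p * (real T * \<bar>h\<bar>) else 0)"
proof -
  define f where "f n = \<bar>r - real n\<bar> powr p" for n
  define c where "c = 2 * 2 powr p * (real T * \<bar>h\<bar>)"
  have c: "c \<ge> 0" by (simp add: c_def)
  have term_le: "second_diff f k * (pair_excess T (displace T i h x) r (Suc k) - pair_excess T x r (Suc k))
     \<le> (if \<bar>r - real (Suc k)\<bar> < \<bar>h\<bar> then c else 0)" for k
  proof -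
    have "second_diff f k * (pair_excess T (displace T i h x) r (Suc k) - pair_excess T x r (Suc k))
      \<le> second_diff f k * (if \<bar>r - real (Suc k)\<bar> < \<bar>h\<bar> then real T * \<bar>h\<bar> else 0)"
      using pair_excess_displace_le[OF x h, of T i r "Suc k"] second_diff_powr_nonneg[OF p, of r k]
      by (intro mult_left_mono) (simp_all add: f_def[abs_def])
    also have "\<dots> \<le> (if \<bar>r - real (Suc k)\<bar> < \<bar>h\<bar> then c else 0)"
    proof (cases "\<bar>r - real (Suc k)\<bar> < \<bar>h\<bar>")
      case True
      then have "second_diff f k \<le> 2 * 2 powr p"
        using second_diff_powr_le[OF p, of r k] h by (simp add: f_def[abs_def] del: of_nat_Suc)
      then show ?thesis using True by (auto simp: c_def intro: mult_right_mono)
    qed auto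
    finally show ?thesis .
  qed
  have "window_energy p T (displace T i h x) r - window_energy p T x r
    \<le> (\<Sum>k<nat \<lceil>r\<rceil> + T. if \<bar>r - real (Suc k)\<bar> < \<bar>h\<bar> then c else 0)"
    unfolding window_energy_diff[OF r] f_def[abs_def, symmetric] by (intro sum_mono term_le)
  also have "\<dots> \<le> (if \<exists>k. \<bar>r - real (Suc k)\<bar> < \<bar>h\<bar> then c else 0)"
  proof (cases "\<exists>k. \<bar>r - real (Suc k)\<bar> < \<bar>h\<bar>")
    case True
    then obtain k0 where k0: "\<bar>r - real (Suc k0)\<bar> < \<bar>h\<bar>" by blast
    have uniq: "k = k0" if "\<bar>r - real (Suc k)\<bar> < \<bar>h\<bar>" for k
    proof -
      have "\<bar>real k - real k0\<bar> < 1" using that k0 h by simp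
      then show ?thesis by linarith
    qed
    have "(\<Sum>k<nat \<lceil>r\<rceil> + T. if \<bar>r - real (Suc k)\<bar> < \<bar>h\<bar> then c else 0)
      \<le> (\<Sum>k<nat \<lceil>r\<rceil> + T. if k = k0 then c else 0)"
    proof (rule sum_mono)
      fix k show "(if \<bar>r - real (Suc k)\<bar> < \<bar>h\<bar> then c else 0) \<le> (if k = k0 then c else 0)"
        using uniq[of k] c by (cases "\<bar>r - real (Suc k)\<bar> < \<bar>h\<bar>") (simp_all del: of_nat_Suc)
    qed
    also have "\<dots> \<le> c" using c by simp
    finally show ?thesis using True by simp
  qed simp
  finally show ?thesis unfolding c_def .
qed

lemma integrable_powr_abs:
  assumes "q > 1"
  shows "integrable lborel (\<lambda>z::real. indicator {1/2..} \<bar>z\<bar> * \<bar>z\<bar> powr (- q))"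
proof -
  define h where "h z = indicator {1/2..} z * z powr (- q)" for z :: real
  have h: "integrable lborel h" unfolding h_def
  proof (rule integrable_lborel_nonneg)
    show "(\<lambda>z::real. z powr (- q)) integrable_on {1/2..}"
      using has_integral_powr_to_inf[of "- q" "1/2"] assms by (auto simp: integrable_on_def)
  qed auto
  have "integrable lborel (\<lambda>z. h (0 + (- 1) * z))"
    by (rule lborel_integrable_real_affine[OF h]) simp
  then have "integrable lborel (\<lambda>z. h z + h (- z))" using h by simp
  moreover have "h z + h (- z) = indicator {1/2..} \<bar>z\<bar> * \<bar>z\<bar> powr (- q)" for z
    by (auto simp: h_def indicator_def abs_if)
  ultimately show ?thesis by simp
qed

lemma AE_abs_not_Ints: "AE r :: real in lborel. \<bar>r\<bar> \<notin> \<int>"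
proof -
  have "(\<int> :: real set) \<in> null_sets lborel"
    by (intro countable_imp_null_set_lborel) (simp add: Ints_def)
  then have "AE r :: real in lborel. r \<notin> \<int>" by (rule AE_not_in)
  then show ?thesis by eventually_elim (auto simp: abs_if split: if_splits)
qed

text \<open>Displacing one point by \<open>h\<close> changes the window energy only for \<open>r\<close> within distance
  \<open>\<bar>h\<bar>\<close> of an integer, and there by \<open>O(h)\<close>; hence the energy changes by \<open>o(h)\<close>.\<close>
lemma energy_displace_has_derivative_0:
  assumes x: "equally_spaced x" and T: "T \<ge> 1" and sp: "p \<ge> 1" "0 < s" "s * p < 1"
  shows "((\<lambda>h. energy s p T (displace T i h x)) has_real_derivative 0) (at 0)"
proof -
  define y where "y h = displace T i h x" for h
  define q where "q = 1 + s * p"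
  define C where "C = 2 * 2 powr p * real T"
  have q: "q > 1" using sp by (simp add: q_def)
  define D where "D h r = energy_density s p T (y h) r - energy_density s p T x r" for h r
  have y: "quasi_periodic T (y h)" if "\<bar>h\<bar> < 1 / 2" for h
    unfolding y_def using x that
    by (intro quasi_periodic_displace quasi_periodic_equally_spaced) (auto simp: equally_spaced_def)
  note x' = quasi_periodic_equally_spaced[OF x, of T]
  have int: "integrable lborel (D h)" if "\<bar>h\<bar> < 1 / 2" for h
    unfolding D_def[abs_def]
    by (intro Bochner_Integration.integrable_diff integrable_energy_density y x' that T sp)
  have diff: "energy s p T (y h) - energy s p T x = (LBINT r. D h r)" if "\<bar>h\<bar> < 1 / 2" for h
    unfolding D_def energy_def
    by (subst Bochner_Integration.integral_diff) (intro integrable_energy_density y x' that T sp refl)+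
  \<comment> \<open>Minimality of the equispaced sequence is the lower bound, so only upper
    estimates of the change are required.\<close>
  have nonneg: "D h r \<ge> 0" if "\<bar>h\<bar> < 1 / 2" for h r
    using window_energy_minimal[OF y[OF that] x sp(1)]
    unfolding D_def energy_density_diff by (intro divide_nonneg_nonneg) auto
  have le: "D h r \<le> (if \<exists>k. \<bar>\<bar>r\<bar> - real (Suc k)\<bar> < \<bar>h\<bar> then C * \<bar>h\<bar> else 0) * \<bar>r\<bar> powr (- q)"
    if "\<bar>h\<bar> < 1 / 2" for h r
    using divide_right_mono[OF window_energy_displace_le[OF x that sp(1), of "\<bar>r\<bar>" T i], of "\<bar>r\<bar> powr q"]
    unfolding D_def energy_density_diff y_def q_def[symmetric] C_def
    by (subst powr_minus_divide) (auto simp: mult.assoc split: if_splits)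
  \<comment> \<open>After division by \<open>\<bar>h\<bar>\<close> the majorant is independent of
    \<open>h\<close>. Being within 1/2 of a positive integer keeps \<open>\<bar>r\<bar>\<close> at
    least 1/2, away from the singularity at 0.\<close>
  have le': "D h r \<le> \<bar>h\<bar> * (C * (indicator {1/2..} \<bar>r\<bar> * \<bar>r\<bar> powr (- q)))" if "\<bar>h\<bar> < 1 / 2" for h r
  proof (cases "\<exists>k. \<bar>\<bar>r\<bar> - real (Suc k)\<bar> < \<bar>h\<bar>")
    case True
    then have "\<bar>r\<bar> \<ge> 1 / 2" using that by auto
    then show ?thesis using le[OF that, of r] True by (simp add: algebra_simps)
  next
    case False
    then have "D h r \<le> 0" using le[OF that, of r] by simp
    also have "0 \<le> \<bar>h\<bar> * (C * (indicator {1/2..} \<bar>r\<bar> * \<bar>r\<bar> powr (- q)))" by (simp add: C_def)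
    finally show ?thesis .
  qed
  have "((\<lambda>h. (energy s p T (y h) - energy s p T x) / h) \<longlongrightarrow> 0) (at 0)"
    unfolding tendsto_at_iff_sequentially comp_def
  proof (intro allI impI)
    fix X :: "nat \<Rightarrow> real"
    assume X: "\<forall>n. X n \<in> UNIV - {0}" "X \<longlonglongrightarrow> 0"
    have "eventually (\<lambda>n. \<bar>X n\<bar> < 1 / 2) sequentially"
      using tendstoD[OF X(2), of "1/2"] by (simp add: dist_real_def)
    then obtain N where N: "\<And>n. n \<ge> N \<Longrightarrow> \<bar>X n\<bar> < 1 / 2" by (auto simp: eventually_sequentially)
    define Y where "Y n = X (n + N)" for n
    have Y: "\<bar>Y n\<bar> < 1 / 2" "Y n \<noteq> 0" for n using N X(1) by (auto simp: Y_def)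
    have Y0: "Y \<longlonglongrightarrow> 0" unfolding Y_def by (rule LIMSEQ_ignore_initial_segment[OF X(2)])
    have "(\<lambda>n. LBINT r. D (Y n) r / Y n) \<longlonglongrightarrow> (LBINT r :: real. 0)"
    proof (rule integral_dominated_convergence)
      show "integrable lborel (\<lambda>r. C * (indicator {1/2..} \<bar>r\<bar> * \<bar>r\<bar> powr (- q)))"
        by (intro integrable_mult_right integrable_powr_abs q)
      show "(\<lambda>r. D (Y n) r / Y n) \<in> borel_measurable lborel" for n
        using int[OF Y(1)[of n]] by (intro borel_measurable_divide) auto
      show "AE r in lborel. norm (D (Y n) r / Y n) \<le> C * (indicator {1/2..} \<bar>r\<bar> * \<bar>r\<bar> powr (- q))" for n
        using le'[OF Y(1)[of n]] nonneg[OF Y(1)[of n]] Y(2)[of n]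
        by (intro AE_I2) (simp add: pos_divide_le_eq mult.commute)
      show "AE r in lborel. (\<lambda>n. D (Y n) r / Y n) \<longlonglongrightarrow> 0"
        using AE_abs_not_Ints
      proof eventually_elim
        case (elim r)
        \<comment> \<open>The distance from \<open>\<bar>r\<bar>\<close> to the integers: once
          \<open>\<bar>Y n\<bar>\<close> is below it, the difference quotient is exactly zero at
          this \<open>r\<close>.\<close>
        define \<delta> where "\<delta> = min (frac \<bar>r\<bar>) (1 - frac \<bar>r\<bar>)"
        have "\<delta> > 0" using elim frac_lt_1[of "\<bar>r\<bar>"] by (simp add: \<delta>_def frac_gt_0_iff)
        have far: "\<bar>\<bar>r\<bar> - real_of_int k\<bar> \<ge> \<delta>" for k
        proof (cases "k \<le> \<lfloor>\<bar>r\<bar>\<rfloor>")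
          case True
          then have "\<bar>r\<bar> - real_of_int k \<ge> frac \<bar>r\<bar>" by (simp add: frac_def)
          then show ?thesis by (simp add: \<delta>_def)
        next
          case False
          then have "real_of_int k \<ge> real_of_int \<lfloor>\<bar>r\<bar>\<rfloor> + 1" by linarith
          then have "real_of_int k - \<bar>r\<bar> \<ge> 1 - frac \<bar>r\<bar>" by (simp add: frac_def)
          then show ?thesis by (simp add: \<delta>_def)
        qed
        have "eventually (\<lambda>n. \<bar>Y n\<bar> < \<delta>) sequentially"
          using tendstoD[OF Y0 \<open>\<delta> > 0\<close>] by (simp add: dist_real_def)
        then have "eventually (\<lambda>n. D (Y n) r / Y n = 0) sequentially"
        proof eventually_elim
          case (elim n)
          then have "\<not> (\<exists>k. \<bar>\<bar>r\<bar> - real (Suc k)\<bar> < \<bar>Y n\<bar>)"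
            using far[of "int (Suc _)"] by (metis leD less_le_trans less_imp_le of_int_of_nat_eq)
          then show ?case
            using le[OF Y(1)[of n], of r] nonneg[OF Y(1)[of n], of r] by simp
        qed
        then show ?case by (rule tendsto_eventually)
      qed
    qed simp
    then have "(\<lambda>n. (energy s p T (y (Y n)) - energy s p T x) / Y n) \<longlonglongrightarrow> 0"
      using Y(1) by (simp add: diff)
    then show "(\<lambda>n. (energy s p T (y (X n)) - energy s p T x) / X n) \<longlonglongrightarrow> 0"
      unfolding Y_def by (rule LIMSEQ_offset)
  qed
  moreover have "y 0 = x" by (auto simp: y_def displace_def)
  ultimately show ?thesis by (simp add: DERIV_def y_def)
qed

subsection \<open>Configurations given by lists\<close>

text \<open>No ordering is built in, since the lists compared in \<open>local_min\<close> and
  \<open>critical_point\<close> may be unsorted or leave the period.\<close>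

definition extend :: "nat \<Rightarrow> real list \<Rightarrow> int \<Rightarrow> real" where
  "extend T xs j = xs ! nat (j mod int T) + real_of_int (j div int T) * real T"

lemma extend_of_nat: "i < T \<Longrightarrow> extend T xs (int i) = xs ! i"
  by (simp add: extend_def)

lemma extend_add_period: "T \<ge> 1 \<Longrightarrow> extend T xs (j + int T) = extend T xs j + real T"
  by (simp add: extend_def algebra_simps)

lemma quasi_periodic_extend: "T \<ge> 1 \<Longrightarrow> mono (extend T xs) \<Longrightarrow> quasi_periodic T (extend T xs)"
  by (simp add: quasi_periodic_def extend_add_period)

lemma extend_unique:
  assumes "\<And>j. x (j + int T) = x j + real T" "\<And>i. i < T \<Longrightarrow> xs ! i = x (int i)" "T \<ge> 1"
  shows "extend T xs = x"
proof
  fix j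
  have "nat (j mod int T) < T" using assms(3) by (simp add: nat_less_iff)
  then have "xs ! nat (j mod int T) = x (j mod int T)"
    using assms(2,3) by simp
  then show "extend T xs j = x j"
    using add_mult_period[of x T "j mod int T" "j div int T"] assms(1) by (simp add: extend_def)
qed

lemma extend_list_update:
  assumes "length xs = T" "i < T"
  shows "extend T (xs[i := xs ! i + h]) = displace T i h (extend T xs)"
proof
  fix j
  have "nat (j mod int T) = i \<longleftrightarrow> j mod int T = int i" using assms by (auto simp: nat_eq_iff)
  then show "extend T (xs[i := xs ! i + h]) j = displace T i h (extend T xs) j"
    using assms by (auto simp: extend_def displace_def nth_list_update)
qed

lemma u_fun_eq:
  assumes "length xs = T"
  shows "u_fun T xs z = z - real_of_int (count_upto T (extend T xs) z)"
proof -
  have "sum_list (map (\<lambda>xi. real_of_int \<lfloor>(z - xi) / real T\<rfloor>) xs)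
      = (\<Sum>i<T. real_of_int \<lfloor>(z - xs ! i) / real T\<rfloor>)"
    using assms by (simp add: sum_list_sum_nth lessThan_atLeast0)
  then show ?thesis by (simp add: u_fun_def count_upto_def extend_of_nat)
qed

lemma F_energy_eq:
  assumes "length xs = T" "quasi_periodic T (extend T xs)" "T \<ge> 1" "p \<ge> 1" "0 < s" "s * p < 1"
  shows "F_energy s p T xs = energy s p T (extend T xs)"
  unfolding F_energy_def u_fun_eq[OF assms(1)] using assms by (intro energy_eq_nn_integral)

lemma config_extend:
  assumes "config T xs" and T: "T \<ge> 1"
  shows "quasi_periodic T (extend T xs)"
proof (rule quasi_periodic_extend[OF T], unfold mono_int_iff, intro allI)
  fix j
  define i where "i = nat (j mod int T)"
  have i: "i < T" using T by (simp add: i_def nat_less_iff)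
  have len: "length xs = T" using assms by (simp add: config_def)
  have j: "j = int i + (j div int T) * int T" using T by (simp add: i_def)
  have "extend T xs (a + m * int T) = extend T xs a + real_of_int m * real T" for a m
    using T by (simp add: extend_def algebra_simps)
  note shift = this[of _ "j div int T"]
  have "extend T xs (int i) \<le> extend T xs (int i + 1)"
  proof (cases "Suc i < T")
    case True
    then have "extend T xs (int i + 1) = xs ! Suc i"
      using extend_of_nat[of "Suc i" T xs] by (simp add: add.commute)
    then show ?thesis
      using assms True i len by (simp add: extend_of_nat config_def sorted_iff_nth_mono)
  next
    case False
    \<comment> \<open>The gap across the end of the period: the last point is below
      \<open>T\<close>, and the next one is the first point moved up by \<open>T\<close>.\<close>
    then have "extend T xs (int i + 1) = xs ! 0 + real T"
      using i extend_add_period[OF T, of xs 0] extend_of_nat[of 0 T xs] T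
      by (metis add.commute add_0 less_Suc_eq not_less_eq of_nat_0 of_nat_Suc less_eq_Suc_le One_nat_def)
    moreover have "xs ! i < real T" "0 \<le> xs ! 0"
      using assms i len T by (auto simp: config_def)
    ultimately show ?thesis using i by (simp add: extend_of_nat)
  qed
  then show "extend T xs j \<le> extend T xs (j + 1)"
    using shift[of "int i"] shift[of "int i + 1"] j by (metis add.assoc add.commute add_right_mono)
qed

lemma config_set_eq_range:
  assumes "length xs = T" "T \<ge> 1"
  shows "config_set T xs = range (extend T xs)"
proof
  show "config_set T xs \<subseteq> range (extend T xs)"
  proof
    fix z assume "z \<in> config_set T xs"
    then obtain i k where "i < T" "z = xs ! i + real_of_int k * real T"
      using assms by (auto simp: config_set_def)
    then have "z = extend T xs (int i + k * int T)"
      by (simp add: extend_def)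
    then show "z \<in> range (extend T xs)" by blast
  qed
  have "nat (j mod int T) < T" for j using assms by (simp add: nat_less_iff)
  then show "range (extend T xs) \<subseteq> config_set T xs"
    using assms unfolding config_set_def extend_def by blast
qed

lemma range_equally_spaced:
  assumes "equally_spaced x"
  shows "range x = (\<lambda>z. real_of_int z + x 0) ` UNIV"
proof -
  have "x j = real_of_int j + x 0" for j
  proof (cases "j \<ge> 0")
    case True
    then show ?thesis using equally_spaced_add[OF assms, of 0 "nat j"] by simp
  next
    case False
    then show ?thesis using equally_spaced_add[OF assms, of j "nat (- j)"] by simp
  qed
  then have "x = (\<lambda>z. real_of_int z + x 0)" by blast
  then show ?thesis by metis
qed

text \<open>The range forgets multiplicities, but quasi-periodicity recovers them: every point has
  another at distance 1 to its right, so no gap exceeds 1, and gaps that average 1 are then all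
  equal to 1.\<close>

lemma equally_spaced_iff_range:
  assumes x: "quasi_periodic T x" and T: "T \<ge> 1"
  shows "equally_spaced x \<longleftrightarrow> (\<exists>a. range x = (\<lambda>z. real_of_int z + a) ` UNIV)"
proof
  assume "\<exists>a. range x = (\<lambda>z. real_of_int z + a) ` UNIV"
  then obtain a where a: "range x = (\<lambda>z. real_of_int z + a) ` UNIV" by blast
  have "x (j + 1) - x j \<le> 1" for j
  proof (rule ccontr)
    assume gt: "\<not> x (j + 1) - x j \<le> 1"
    have "x j \<in> (\<lambda>z. real_of_int z + a) ` UNIV" using a by blast
    then obtain z where "x j = real_of_int z + a" by blast
    then have "x j + 1 = real_of_int (z + 1) + a" by simp
    then have "x j + 1 \<in> range x" unfolding a by blast
    then obtain m where m: "x m = x j + 1" by auto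
    then show False
      using gt quasi_periodicD(1)[OF x, of m j] quasi_periodicD(1)[OF x, of "j + 1" m] by linarith
  qed
  then show "equally_spaced x" using equally_spaced_gaps[OF x T] by blast
qed (use range_equally_spaced in blast)

lemma translate_of_eq_iff:
  assumes "config T xs" "T \<ge> 1"
  shows "translate_of_eq T xs \<longleftrightarrow> equally_spaced (extend T xs)"
  using equally_spaced_iff_range[OF config_extend[OF assms] assms(2)] assms
  by (simp add: translate_of_eq_def config_set_eq_range config_def)

lemma config_integers:
  assumes "T \<ge> 1"
  shows "config T (map real [0..<T])" "extend T (map real [0..<T]) = real_of_int"
  using assms by (auto simp: config_def sorted_map sorted_wrt_upt intro!: extend_unique)

lemma equally_spaced_of_int: "equally_spaced real_of_int"
  by (simp add: equally_spaced_def)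

section \<open>Local and global minimisers\<close>

lemma extend_convex_combination:
  assumes "length xs = T" "T \<ge> 1"
  shows "extend T (map (\<lambda>i. (1 - t) * xs ! i + t * real i) [0..<T])
    = (\<lambda>j. (1 - t) * extend T xs j + t * real_of_int j)"
proof (rule extend_unique[OF _ _ assms(2)])
  show "(1 - t) * extend T xs (j + int T) + t * real_of_int (j + int T)
    = (1 - t) * extend T xs j + t * real_of_int j + real T" for j
    unfolding extend_add_period[OF assms(2)] by (simp add: algebra_simps)
qed (simp add: extend_of_nat)

lemma energy_convex_two:
  assumes x: "quasi_periodic T x" "quasi_periodic T y" and t: "0 \<le> t" "t \<le> 1"
    and T: "T \<ge> 1" and sp: "p \<ge> 1" "0 < s" "s * p < 1"
  shows "quasi_periodic T (\<lambda>j. (1 - t) * x j + t * y j)"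
    and "energy s p T (\<lambda>j. (1 - t) * x j + t * y j) \<le> (1 - t) * energy s p T x + t * energy s p T y"
proof -
  let ?w = "\<lambda>b. if b then t else 1 - t" and ?x = "\<lambda>b. if b then y else x"
  have w: "finite (UNIV :: bool set)" "\<And>b. ?w b \<ge> 0" "sum ?w UNIV = 1"
    using t by (auto simp: UNIV_bool)
  have x': "quasi_periodic T (?x b)" for b using x by simp
  show "quasi_periodic T (\<lambda>j. (1 - t) * x j + t * y j)"
    using quasi_periodic_convex_combination[of UNIV T ?x ?w] w x' by (simp add: UNIV_bool add.commute)
  show "energy s p T (\<lambda>j. (1 - t) * x j + t * y j) \<le> (1 - t) * energy s p T x + t * energy s p T y"
    using energy_convex[of UNIV ?w T ?x p s] w x' T sp by (simp add: UNIV_bool add.commute)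
qed

lemma local_min_iff:
  assumes xs: "config T xs" and T: "T \<ge> 1" and sp: "p \<ge> 1" "0 < s" "s * p < 1"
  shows "local_min s p T xs \<longleftrightarrow> equally_spaced (extend T xs)"
proof
  define x where "x = extend T xs"
  have x: "quasi_periodic T x" unfolding x_def by (rule config_extend[OF xs T])
  have len: "length xs = T" using xs by (simp add: config_def)
  have Fx: "F_energy s p T xs = energy s p T x"
    using F_energy_eq[OF len _ T sp] x by (simp add: x_def)
  show "local_min s p T xs" if eq: "equally_spaced (extend T xs)"
    unfolding local_min_def
  \<comment> \<open>Neighbours at distance 1 that move by less than 1/2 each cannot change order, so
    every list in this neighbourhood is covered by \<open>energy_minimal\<close>.\<close>
  proof (intro exI[of _ "1 / 2"] conjI allI impI)
    fix ys :: "real list"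
    assume ys: "length ys = length xs" "\<forall>i<length xs. \<bar>ys ! i - xs ! i\<bar> < 1 / 2"
    have close: "\<bar>extend T ys j - extend T xs j\<bar> < 1 / 2" for j
    proof -
      have "nat (j mod int T) < T" using T by (simp add: nat_less_iff)
      then show ?thesis using ys(2) len by (simp add: extend_def)
    qed
    have "extend T ys j \<le> extend T ys (j + 1)" for j
    proof -
      have "extend T xs (j + 1) = extend T xs j + 1" using eq by (simp add: equally_spaced_def)
      then show ?thesis using close[of j] close[of "j + 1"] by linarith
    qed
    then have y: "quasi_periodic T (extend T ys)"
      by (intro quasi_periodic_extend T) (simp add: mono_int_iff)
    show "F_energy s p T xs \<le> F_energy s p T ys"
      using energy_minimal[OF y eq T sp] F_energy_eq[OF _ y T sp] Fx len ys(1) by (simp add: x_def)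
  qed simp
  show "equally_spaced (extend T xs)" if min: "local_min s p T xs"
  proof (rule ccontr)
    assume ne: "\<not> equally_spaced (extend T xs)"
    from min obtain e where e: "e > 0" "\<And>ys. length ys = length xs \<Longrightarrow>
      (\<forall>i<length xs. \<bar>ys ! i - xs ! i\<bar> < e) \<Longrightarrow> F_energy s p T xs \<le> F_energy s p T ys"
      unfolding local_min_def by blast
    \<comment> \<open>A step towards the integers moves each point by at most \<open>t * T\<close>,
      since both \<open>i\<close> and \<open>xs ! i\<close> lie in the period; this \<open>t\<close>
      makes that less than \<open>e\<close>.\<close>
    define t where "t = min 1 (e / (2 * real T))"
    have t: "0 < t" "t \<le> 1" "t * real T < e"
    proof -
      show "0 < t" "t \<le> 1" using e(1) T by (auto simp: t_def)
      have "t * real T \<le> e / (2 * real T) * real T" unfolding t_def by (intro mult_right_mono) auto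
      also have "\<dots> < e" using e(1) T by simp
      finally show "t * real T < e" .
    qed
    define ys where "ys = map (\<lambda>i. (1 - t) * xs ! i + t * real i) [0..<T]"
    have Ey: "extend T ys = (\<lambda>j. (1 - t) * x j + t * real_of_int j)"
      unfolding ys_def x_def by (rule extend_convex_combination[OF len T])
    note I = quasi_periodic_equally_spaced[OF equally_spaced_of_int, of T]
    have y: "quasi_periodic T (extend T ys)"
      unfolding Ey using t by (intro energy_convex_two(1)[OF x I _ _ T sp]) auto
    have "F_energy s p T xs \<le> F_energy s p T ys"
    proof (rule e(2))
      show "length ys = length xs" by (simp add: ys_def len)
      show "\<forall>i<length xs. \<bar>ys ! i - xs ! i\<bar> < e"
      proof (intro allI impI)
        fix i assume i: "i < length xs"
        have "0 \<le> xs ! i" "xs ! i < real T" using xs i by (auto simp: config_def)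
        then have "\<bar>real i - xs ! i\<bar> \<le> real T" using i len by linarith
        then have "\<bar>t * (real i - xs ! i)\<bar> \<le> t * real T" using t by (simp add: abs_mult)
        moreover have "ys ! i - xs ! i = t * (real i - xs ! i)"
          using i len by (simp add: ys_def algebra_simps)
        ultimately show "\<bar>ys ! i - xs ! i\<bar> < e" using t by simp
      qed
    qed
    also have "\<dots> = energy s p T (extend T ys)"
      by (rule F_energy_eq[OF _ y T sp]) (simp add: ys_def)
    also have "\<dots> \<le> (1 - t) * energy s p T x + t * energy s p T real_of_int"
      unfolding Ey using t by (intro energy_convex_two(2)[OF x I _ _ T sp]) auto
    also have "\<dots> < (1 - t) * energy s p T x + t * energy s p T x"
      using energy_strictly_minimal[OF x equally_spaced_of_int _ T sp] ne t by (simp add: x_def)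
    finally show False by (simp add: Fx algebra_simps)
  qed
qed

lemma global_min_iff:
  assumes xs: "config T xs" and T: "T \<ge> 1" and sp: "p \<ge> 1" "0 < s" "s * p < 1"
  shows "global_min s p T xs \<longleftrightarrow> equally_spaced (extend T xs)"
proof
  have F: "F_energy s p T ys = energy s p T (extend T ys)" if "config T ys" for ys
    using that by (intro F_energy_eq config_extend T sp) (auto simp: config_def)
  show "global_min s p T xs" if "equally_spaced (extend T xs)"
    using energy_minimal[OF config_extend[OF _ T] that T sp] F[OF xs] F by (simp add: global_min_def)
  show "equally_spaced (extend T xs)" if "global_min s p T xs"
  proof (rule ccontr)
    assume "\<not> equally_spaced (extend T xs)"
    from energy_strictly_minimal[OF config_extend[OF xs T] equally_spaced_of_int this T sp]
    show False
      using that config_integers[OF T] F[OF xs] F[OF config_integers(1)[OF T]]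
      by (auto simp: global_min_def)
  qed
qed

section \<open>Critical points\<close>

lemma config0_gap:
  assumes xs: "config0 T xs" and T: "T \<ge> 1"
  obtains d where "d > 0" "\<And>j. extend T xs (j + 1) - extend T xs j \<ge> 2 * d"
proof -
  define x where "x = extend T xs"
  have c: "config T xs" "length xs = T" using xs by (auto simp: config0_def config_def)
  have x: "quasi_periodic T x" unfolding x_def by (rule config_extend[OF c(1) T])
  have pos: "x (int i + 1) - x (int i) > 0" if i: "i < T" for i
  proof -
    have "x (int i + 1) \<noteq> x (int i)"
    proof (cases "Suc i < T")
      case True
      then show ?thesis
        using extend_of_nat[of "Suc i" T xs] extend_of_nat[of i T xs] xs i c
        by (simp add: x_def config0_def add.commute)
    next
      case False
      then have "Suc i = T" using i by simp
      then have "int i + 1 = 0 + int T" by linarith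
      then have "x (int i + 1) = xs ! 0 + real T"
        unfolding x_def using extend_add_period[OF T, of xs 0] extend_of_nat[of 0 T xs] T
        by simp
      moreover have "xs ! i < real T" "0 \<le> xs ! 0" using c i T by (auto simp: config_def)
      ultimately show ?thesis using i by (simp add: x_def extend_of_nat)
    qed
    then show ?thesis using quasi_periodicD(1)[OF x, of "int i" "int i + 1"] by simp
  qed
  define m where "m = Min ((\<lambda>i. x (int i + 1) - x (int i)) ` {..<T})"
  have "m > 0" unfolding m_def using pos T by (subst Min_gr_iff) (auto simp: lessThan_empty_iff)
  moreover have "x (j + 1) - x j \<ge> m" for j
  proof -
    have "nat (j mod int T) \<in> {..<T}" using T by (simp add: nat_less_iff)
    then have "m \<le> x (int (nat (j mod int T)) + 1) - x (int (nat (j mod int T)))"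
      unfolding m_def by (intro Min_le imageI) auto
    then show ?thesis using quasi_periodic_gap_mod[OF x, of j] T by simp
  qed
  ultimately show thesis using that[of "m / 2"] by (simp add: x_def)
qed

lemma F_energy_list_update:
  assumes "config T xs" "i < T" and gap: "\<And>j. \<bar>h\<bar> \<le> (extend T xs (j + 1) - extend T xs j) / 2"
    and T: "T \<ge> 1" and sp: "p \<ge> 1" "0 < s" "s * p < 1"
  shows "F_energy s p T (xs[i := xs ! i + h]) = energy s p T (displace T i h (extend T xs))"
proof -
  have len: "length xs = T" using assms by (simp add: config_def)
  have "quasi_periodic T (displace T i h (extend T xs))"
    by (intro quasi_periodic_displace config_extend assms gap)
  then show ?thesis
    using F_energy_eq[of "xs[i := xs ! i + h]" T p s] extend_list_update[OF len assms(2)] len T sp by simp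
qed

text \<open>With \<open>v = e - x\<close>, the configuration \<open>x\<close> is a convex combination of \<open>e\<close> and of
  displacements of single points:
  \<open>(1 + t) x = t e + (1 / T) (\<Sum>i<T. x - T t v\<^sub>i 1\<^sub>i)\<close>.\<close>
lemma energy_le_displacements:
  assumes x: "quasi_periodic T x" and e: "quasi_periodic T e" and t: "t \<ge> 0"
    and disp: "\<And>i. i < T \<Longrightarrow> quasi_periodic T (displace T i (real T * (x (int i) - e (int i)) * t) x)"
    and T: "T \<ge> 1" and sp: "p \<ge> 1" "0 < s" "s * p < 1"
  shows "(1 + t) * energy s p T x \<le> t * energy s p T e
    + (\<Sum>i<T. energy s p T (displace T i (real T * (x (int i) - e (int i)) * t) x)) / real T"
proof -
  \<comment> \<open>Dividing the identity by \<open>1 + t\<close> makes it a convex combination;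
    indices below \<open>T\<close> carry the displacements and index \<open>T\<close> carries
    \<open>e\<close>.\<close>
  define w where "w a = (if a < T then 1 / (real T * (1 + t)) else t / (1 + t))" for a
  define y where "y a = (if a < T then displace T a (real T * (x (int a) - e (int a)) * t) x else e)" for a
  have pos: "real T > 0" "1 + t > 0" using T t by auto
  have "(\<Sum>a<Suc T. w a * y a j) = x j" for j
  proof -
    define l where "l = nat (j mod int T)"
    have l: "l < T" "j mod int T = int l" using T by (auto simp: l_def nat_less_iff)
    have j: "int l + j div int T * int T = j"
      using mod_div_mult_eq[of j "int T"] l(2) by simp
    have per: "z j = z (int l) + real_of_int (j div int T) * real T" if "quasi_periodic T z" for z
      using quasi_periodic_add_mult[OF that, of "int l" "j div int T"] unfolding j .
    have v: "x (int l) - e (int l) = x j - e j" using per[OF x] per[OF e] by simp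
    have "(\<Sum>a<T. y a j) = (\<Sum>a<T. x j + (if a = l then real T * (x j - e j) * t else 0))"
      using l v by (intro sum.cong) (auto simp: y_def displace_def)
    also have "\<dots> = real T * (x j + (x j - e j) * t)"
      using l by (simp add: sum.distrib algebra_simps)
    finally have S: "(\<Sum>a<T. y a j) = real T * (x j + (x j - e j) * t)" .
    have "(\<Sum>a<Suc T. w a * y a j) = (\<Sum>a<T. y a j) / (real T * (1 + t)) + t * e j / (1 + t)"
      by (simp add: w_def y_def sum_divide_distrib)
    also have "\<dots> = (x j + (x j - e j) * t + t * e j) / (1 + t)"
      unfolding S using pos(1) by (simp add: add_divide_distrib)
    also have "x j + (x j - e j) * t + t * e j = (1 + t) * x j" by (simp add: algebra_simps)
    also have "(1 + t) * x j / (1 + t) = x j" using pos(2) by simp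
    finally show ?thesis .
  qed
  then have comb: "(\<lambda>j. \<Sum>a<Suc T. w a * y a j) = x" by blast
  have "energy s p T (\<lambda>j. \<Sum>a<Suc T. w a * y a j) \<le> (\<Sum>a<Suc T. w a * energy s p T (y a))"
  proof (rule energy_convex)
    have "sum w {..<Suc T} = 1 / (1 + t) + t / (1 + t)" using pos(1) by (simp add: w_def)
    then show "sum w {..<Suc T} = 1" using pos(2) by (simp add: add_divide_distrib[symmetric])
    show "w a \<ge> 0" for a using t by (simp add: w_def)
    show "quasi_periodic T (y a)" for a using disp e by (simp add: y_def)
  qed (use T sp in auto)
  also have "\<dots> = (\<Sum>a<T. energy s p T (y a)) / (real T * (1 + t)) + t * energy s p T e / (1 + t)"
    by (simp add: w_def y_def sum_divide_distrib)
  finally have "energy s p T x \<le> ((\<Sum>a<T. energy s p T (y a)) / real T + t * energy s p T e) / (1 + t)"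
    unfolding comb by (simp add: add_divide_distrib)
  then have "(1 + t) * energy s p T x \<le> (\<Sum>a<T. energy s p T (y a)) / real T + t * energy s p T e"
    using pos by (simp add: pos_le_divide_eq mult.commute)
  then show ?thesis by (simp add: y_def)
qed

lemma critical_point_iff:
  assumes xs: "config0 T xs" and T: "T \<ge> 1" and sp: "p \<ge> 1" "0 < s" "s * p < 1"
  shows "critical_point s p T xs \<longleftrightarrow> equally_spaced (extend T xs)"
proof -
  define x where "x = extend T xs"
  have c: "config T xs" "length xs = T" using xs by (auto simp: config0_def config_def)
  have x: "quasi_periodic T x" unfolding x_def by (rule config_extend[OF c(1) T])
  obtain d where d: "d > 0" "\<And>j. x (j + 1) - x j \<ge> 2 * d"
    using config0_gap[OF xs T] unfolding x_def by blast
  have gap: "\<bar>h\<bar> \<le> (x (j + 1) - x j) / 2" if "\<bar>h\<bar> < d" for h j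
    using d(2)[of j] that by simp
  have F: "F_energy s p T (xs[i := xs ! i + h]) = energy s p T (displace T i h x)"
    if "i < T" "\<bar>h\<bar> < d" for i h
    unfolding x_def by (rule F_energy_list_update[OF c(1) that(1) _ T sp]) (use gap[OF that(2)] x_def in blast)
  show ?thesis
  proof
    assume "equally_spaced (extend T xs)"
    then have eq: "equally_spaced x" by (simp add: x_def)
    show "critical_point s p T xs"
      unfolding critical_point_def
    proof (intro allI impI)
      fix i assume "i < length xs"
      then have i: "i < T" using c by simp
      have "open {-d<..<d}" "0 \<in> {-d<..<d}" using d(1) by auto
      then show "((\<lambda>h. F_energy s p T (xs[i := xs ! i + h])) has_real_derivative 0) (at 0)"
        using F[OF i]
        by (intro has_field_derivative_transform_within_open
              [where S = "{-d<..<d}", OF energy_displace_has_derivative_0[OF eq T sp, of i]]) auto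
    qed
  next
    assume crit: "critical_point s p T xs"
    show "equally_spaced (extend T xs)"
    proof (rule ccontr)
      assume ne: "\<not> equally_spaced (extend T xs)"
      define D where "D = energy s p T x - energy s p T real_of_int"
      have D: "D > 0"
        using energy_strictly_minimal[OF x equally_spaced_of_int _ T sp] ne by (simp add: D_def x_def)
      define v where "v i = real T * (x (int i) - real_of_int (int i))" for i
      \<comment> \<open>The displacement inequality rearranges to
        \<open>energy s p T x \<le> \<psi> t\<close> for small \<open>t \<ge> 0\<close>, with
        equality at 0. Vanishing partial derivatives give \<open>\<psi>\<close> the slope
        \<open>- D < 0\<close> there, which is the contradiction.\<close>
      define \<psi> where "\<psi> t = (\<Sum>i<T. F_energy s p T (xs[i := xs ! i + v i * t])) / real T - t * D" for t
      have "(\<psi> has_real_derivative ((\<Sum>i<T. 0 * v i) / real T - 1 * D)) (at 0)"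
        unfolding \<psi>_def
      proof (intro DERIV_diff DERIV_cdivide DERIV_sum DERIV_cmult_right DERIV_ident)
        fix i assume "i \<in> {..<T}"
        then have "((\<lambda>h. F_energy s p T (xs[i := xs ! i + h])) has_real_derivative 0) (at (v i * 0))"
          using crit c by (simp add: critical_point_def)
        moreover have "((\<lambda>t. v i * t) has_real_derivative v i) (at 0)"
          by (auto intro!: derivative_eq_intros)
        ultimately show "((\<lambda>t. F_energy s p T (xs[i := xs ! i + v i * t])) has_real_derivative 0 * v i) (at 0)"
          by (rule DERIV_chain2)
      qed
      then have "(\<psi> has_real_derivative (- D)) (at 0)" by simp
      from DERIV_neg_dec_right[OF this] D obtain \<tau> where
        \<tau>: "\<tau> > 0" "\<And>h. 0 < h \<Longrightarrow> h < \<tau> \<Longrightarrow> \<psi> h < \<psi> 0" by auto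
      \<comment> \<open>A common bound for all \<open>\<bar>v i\<bar>\<close>, with
        \<open>+ 1\<close> to allow division by it; the choice of \<open>t\<close> then keeps every
        displacement at most \<open>d / 2\<close>, so the order of the points is preserved.\<close>
      define M where "M = (\<Sum>i<T. \<bar>v i\<bar>) + 1"
      have M: "M > 0" unfolding M_def by (intro add_nonneg_pos sum_nonneg) auto
      define t where "t = min (\<tau> / 2) (d / (2 * M))"
      have t: "0 < t" "t < \<tau>" using \<tau>(1) d(1) M by (auto simp: t_def)
      have small: "\<bar>v i * t\<bar> < d" if "i < T" for i
      proof -
        have "\<bar>v i\<bar> \<le> (\<Sum>i<T. \<bar>v i\<bar>)" using that by (intro member_le_sum) auto
        then have "\<bar>v i\<bar> \<le> M" by (simp add: M_def)
        moreover have "t \<le> d / (2 * M)" by (simp add: t_def)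
        ultimately have "\<bar>v i\<bar> * t \<le> M * (d / (2 * M))" using t M by (intro mult_mono) auto
        also have "\<dots> < d" using M d(1) by simp
        finally show ?thesis using t by (simp add: abs_mult)
      qed
      have "(1 + t) * energy s p T x \<le> t * energy s p T real_of_int
        + (\<Sum>i<T. energy s p T (displace T i (v i * t) x)) / real T"
        unfolding v_def
      proof (rule energy_le_displacements[OF x _ _ _ T sp])
        show "quasi_periodic T (displace T i (real T * (x (int i) - real_of_int (int i)) * t) x)"
          if "i < T" for i
          using quasi_periodic_displace[OF x gap[OF small[OF that]]] by (simp add: v_def)
      qed (use t quasi_periodic_equally_spaced[OF equally_spaced_of_int] in auto)
      also have "(\<Sum>i<T. energy s p T (displace T i (v i * t) x))
        = (\<Sum>i<T. F_energy s p T (xs[i := xs ! i + v i * t]))"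
        using F small by (intro sum.cong) auto
      finally have "energy s p T x \<le> \<psi> t" by (simp add: \<psi>_def D_def algebra_simps)
      moreover have "\<psi> 0 = energy s p T x"
        using T F_energy_eq[OF c(2) _ T sp] x by (simp add: \<psi>_def x_def)
      ultimately show False using \<tau>(2)[OF t] by simp
    qed
  qed
qed

theorem mainTheorem8:
  fixes s p :: real and T :: nat
  assumes "p \<ge> 1" and "0 < s" and "s < 1" and "s * p < 1" and "T \<ge> 1"
  shows "(\<forall>xs. config0 T xs \<longrightarrow> (critical_point s p T xs \<longleftrightarrow> translate_of_eq T xs))
       \<and> (\<forall>xs. config T xs \<longrightarrow> (local_min s p T xs \<longleftrightarrow> translate_of_eq T xs))
       \<and> (\<forall>xs. config T xs \<longrightarrow> (global_min s p T xs \<longleftrightarrow> translate_of_eq T xs))"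
proof (intro conjI allI impI)
  show "critical_point s p T xs \<longleftrightarrow> translate_of_eq T xs" if "config0 T xs" for xs
    using that assms critical_point_iff[of T xs p s] translate_of_eq_iff[of T xs]
    by (simp add: config0_def)
qed (use assms in \<open>simp_all add: local_min_iff global_min_iff translate_of_eq_iff\<close>)

end
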